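(* Let $\mu=\mu_1\otimes\mu_2\otimes\cdots\otimes\mu_n$ be a product probability measure on a product space $\Omega=\Omega_1\otimes\Omega_2\otimes\cdots\otimes\Omega_n$ of Polish spaces. Let $\boldsymbol{f}:\Omega\to\mathbb{H}_d$ be a suitable function. Define the variance proxy $v_{\boldsymbol{f}}:=\big\|\,\|\boldsymbol{V}(\boldsymbol{f})\|\,\big\|_{L_\infty(\mu)}$, where $$\boldsymbol{V}(\boldsymbol{f})(z):=\frac12\sum_{i=1}^n\mathbb{E}_Z\Big[\big(\boldsymbol{f}(z)-\boldsymbol{f}((z;Z)_i)\big)^2\Big]\quad\text{for }z\in\Omega.$$ Then, for all $t\ge0$, $$\mathbb{P}_\mu\{\lambda_{\max}(\boldsymbol{f}-\mathbb{E}_\mu\boldsymbol{f})\ge t\}\le d\cdot\exp\left(-\frac{t^2}{4v_{\boldsymbol{f}}}\right).$$ Furthermore, $$\mathbb{E}_\mu\lambda_{\max}(\boldsymbol{f}-\mathbb{E}_\mu\boldsymbol{f})\le2\sqrt{v_{\boldsymbol{f}}\log d}.$$ Parallel results hold for the minimum eigenvalue: $\mathbb{P}_\mu\{\lambda_{\min}(\boldsymbol{f}-\mathbb{E}_\mu\boldsymbol{f})\le-t\}\le d\cdot\exp(-t^2/(4v_{\boldsymbol{f}}))$ for all $t\ge0$, and $\mathbb{E}_\mu\lambda_{\min}(\boldsymbol{f}-\mathbb{E}_\mu\boldsymbol{f})\ge-2\sqrt{v_{\boldsymbol{f}}\log d}$.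
   Context: $\mathbb{H}_d$ is the space of $d\times d$ complex Hermitian matrices; $\|\cdot\|$ is the $\ell_2$ operator norm; $\lambda_{\max},\lambda_{\min}$ are the largest and smallest eigenvalues. $\mathbb{E}_\mu$ is the entrywise expectation. $Z=(Z^1,\dots,Z^n)\sim\mu$ (superscripts are coordinate indices) and $(z;Z)_i=(z^1,\dots,z^{i-1},Z^i,z^{i+1},\dots,z^n)$. A suitable function here is a measurable function $\boldsymbol{f}:\Omega\to\mathbb{H}_d$ with $\mathbb{E}_\mu\|\boldsymbol{f}\|^2<\infty$, so that $\boldsymbol{V}(\boldsymbol{f})$ is defined $\mu$-almost everywhere; the results are of interest when $v_{\boldsymbol{f}}<\infty$. *)

theory Defs
  imports "HOL-Analysis.Analysis" "HOL-Probability.Probability" "HOL-Probability.Essential_Supremum"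
begin

section \<open>Hermitian matrices\<close>

definition hermitian_mat :: "complex ^ 'd ^ 'd \<Rightarrow> bool" where
  "hermitian_mat A \<longleftrightarrow> (\<forall>i j. A $ i $ j = cnj (A $ j $ i))"

definition is_eigenvalue :: "complex ^ 'd ^ 'd \<Rightarrow> complex \<Rightarrow> bool" where
  "is_eigenvalue A c \<longleftrightarrow> (\<exists>x. x \<noteq> 0 \<and> A *v x = c *s x)"

text \<open>The next two definitions are intended for Hermitian matrices, all of whose eigenvalues are real.\<close>

definition lambda_max :: "complex ^ 'd ^ 'd \<Rightarrow> real" where
  "lambda_max A = Max {r. is_eigenvalue A (complex_of_real r)}"

definition lambda_min :: "complex ^ 'd ^ 'd \<Rightarrow> real" where
  "lambda_min A = Min {r. is_eigenvalue A (complex_of_real r)}"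

text \<open>The norm of \<^typ>\<open>complex ^ 'd\<close> is the Euclidean one, so this is the \<open>l\<^sub>2\<close> operator
  norm; the library norm of a matrix type is the Frobenius norm instead.\<close>

definition op_norm :: "complex ^ 'd ^ 'd \<Rightarrow> real" where
  "op_norm A = onorm (\<lambda>x. A *v x)"

definition mat_expectation :: "'a measure \<Rightarrow> ('a \<Rightarrow> complex ^ 'd ^ 'd) \<Rightarrow> complex ^ 'd ^ 'd" where
  "mat_expectation M F = (\<chi> i j. integral\<^sup>L M (\<lambda>z. F z $ i $ j))"


section \<open>Polish spaces\<close>

definition polish_topology :: "'a topology \<Rightarrow> bool" where
  "polish_topology T \<longleftrightarrow> separable_space T \<and> completely_metrizable_space T"

definition borel_prob_on :: "'a topology \<Rightarrow> 'a measure \<Rightarrow> bool" where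
  "borel_prob_on T M \<longleftrightarrow>
     prob_space M \<and> space M = topspace T \<and> sets M = sigma_sets (topspace T) {U. openin T U}"


section \<open>Matrix variance proxy\<close>

text \<open>Points of the product space are (extensional) functions on \<open>{1..n}\<close>; the vector
  \<open>(z;Z)\<^sub>i\<close> is \<open>z(i := Z i)\<close>.\<close>

definition matrix_variance ::
  "nat \<Rightarrow> (nat \<Rightarrow> 'a) measure \<Rightarrow> ((nat \<Rightarrow> 'a) \<Rightarrow> complex ^ 'd ^ 'd) \<Rightarrow> (nat \<Rightarrow> 'a) \<Rightarrow> complex ^ 'd ^ 'd"
  where
  "matrix_variance n \<mu> f z = (1/2) *\<^sub>R (\<Sum>i = 1..n.
     mat_expectation \<mu> (\<lambda>Z. (f z - f (z(i := Z i))) ** (f z - f (z(i := Z i)))))"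

definition variance_proxy ::
  "nat \<Rightarrow> (nat \<Rightarrow> 'a) measure \<Rightarrow> ((nat \<Rightarrow> 'a) \<Rightarrow> complex ^ 'd ^ 'd) \<Rightarrow> ereal" where
  "variance_proxy n \<mu> f = esssup \<mu> (\<lambda>z. ereal (op_norm (matrix_variance n \<mu> f z)))"

definition suitable :: "(nat \<Rightarrow> 'a) measure \<Rightarrow> ((nat \<Rightarrow> 'a) \<Rightarrow> complex ^ 'd ^ 'd) \<Rightarrow> bool" where
  "suitable \<mu> f \<longleftrightarrow> f \<in> borel_measurable \<mu> \<and> (\<forall>z \<in> space \<mu>. hermitian_mat (f z)) \<and>
     (\<integral>\<^sup>+ z. ennreal ((op_norm (f z))\<^sup>2) \<partial>\<mu>) < \<infinity>"


section \<open>Extended-real exponential and square root\<close>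

text \<open>The variance proxy may be \<open>0\<close> or \<open>\<infinity>\<close>. In \<^typ>\<open>ereal\<close>, for real \<open>t\<close>, the quotient
  \<open>t\<^sup>2 / (4 * v)\<close> is \<open>\<infinity>\<close> if \<open>v = 0\<close> and \<open>t \<noteq> 0\<close>, and \<open>0\<close> if \<open>v = \<infinity>\<close> or \<open>t = 0\<close>; hence
  the tail bound is \<open>0\<close> for \<open>v = 0\<close> and \<open>t \<noteq> 0\<close>. Also \<open>\<infinity> * 0 = 0\<close>.\<close>

definition exp_ereal :: "ereal \<Rightarrow> ereal" where
  "exp_ereal x = (case x of ereal r \<Rightarrow> ereal (exp r) | PInfty \<Rightarrow> \<infinity> | MInfty \<Rightarrow> 0)"

text \<open>Only used for nonnegative arguments.\<close>

definition sqrt_ereal :: "ereal \<Rightarrow> ereal" where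
  "sqrt_ereal x = (case x of ereal r \<Rightarrow> ereal (sqrt r) | PInfty \<Rightarrow> \<infinity> | MInfty \<Rightarrow> -\<infinity>)"

end

theory Submission
  imports Defs
begin

text \<open>
  Write \<open>X = f - E f\<close> and \<open>m(\<theta>) = E tr exp(\<theta> X)\<close>. Everything follows from
  \<open>m(\<theta>) \<le> d exp(v \<theta>\<^sup>2)\<close>: since \<open>exp(\<theta> \<lambda>) \<le> tr exp(\<theta> X)\<close> for each eigenvalue \<open>\<lambda>\<close> of \<open>X\<close>, Markov's
  inequality at \<open>\<theta> = t / (2 v)\<close> gives the tail, and Jensen's inequality, optimised over \<open>\<theta>\<close>, gives the
  mean. The smallest eigenvalue is covered by passing to \<open>-f\<close>, which has the same variance proxy.

  The bound on \<open>m\<close> comes from \<open>m'(\<theta>) = E tr(X exp(\<theta> X)) \<le> 2 v \<theta> m(\<theta>)\<close>. To prove it, take an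
  independent copy \<open>Z'\<close> of \<open>Z\<close> and let \<open>Z\<^sup>R\<close> be \<open>Z\<close> with the coordinates in \<open>R\<close> replaced by those of
  \<open>Z'\<close>. The number \<open>E tr(X(Z\<^sup>R) exp(\<theta> X(Z)))\<close> is \<open>m'(\<theta>)\<close> for \<open>R = {}\<close> and, by independence, \<open>0\<close> when
  \<open>R\<close> is everything. Let \<open>R\<close> grow one coordinate at a time, averaging over all sets of a given size. In
  one step from \<open>R\<close> to \<open>R \<union> {i}\<close>, exchanging the two copies of coordinate \<open>i\<close> changes the sign of
  \<open>C = X(Z\<^sup>R) - X(Z\<^bsup>R \<union> {i}\<^esup>)\<close>, so the increment is half of \<open>E tr(C (exp(\<theta> X(Z)) - exp(\<theta> X(Z\<^bsup>{i}\<^esup>))))\<close>.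
  The mean value trace inequality \<open>re_trace_exp_difference\<close> bounds it by
  \<open>E tr((s \<theta>\<^sup>2 D\<^sup>2 + C\<^sup>2 / s) exp(\<theta> X(Z))) / 4\<close> with \<open>D = X(Z) - X(Z\<^bsup>{i}\<^esup>)\<close>. For fixed \<open>R\<close> the sum over
  \<open>i \<notin> R\<close> of the \<open>C\<^sup>2\<close> terms is at most \<open>2 v m(\<theta>)\<close>, because the squares average to parts of the matrix
  variance at the point \<open>Z\<^sup>R\<close>. There are \<open>n - k\<close> choices of \<open>i\<close> when \<open>R\<close> has \<open>k\<close> elements, and
  \<open>s = sqrt(n / (n - k)) / \<theta>\<close> balances the two terms: the increment at level \<open>k\<close> is at most
  \<open>v \<theta> m(\<theta>) / sqrt(n (n - k))\<close>, and these bounds sum to at most \<open>2 v \<theta> m(\<theta>)\<close> (lemma \<open>mgf_deriv_le\<close>). This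
  averaging over subsets is a discrete substitute for the semigroup that refreshes every coordinate at
  unit rate.

  Exponential moments exist because a finite variance proxy makes \<open>X\<close> essentially bounded: each resampled
  coordinate moves \<open>f\<close> by a bounded amount on average, and resampling all of them produces an independent
  copy (lemma \<open>resample_many_bound\<close>).

  Spectral facts are taken from the real Euclidean structure of \<open>\<complex>\<^sup>d\<close>, for which a Hermitian matrix is a
  self-adjoint operator on a space of real dimension \<open>2 d\<close>. Sums over real eigenbases are therefore twice
  the complex trace.
\<close>

section \<open>Orthonormal bases and the real spectral theorem\<close>

definition orthonormal_basis :: "'e::euclidean_space set \<Rightarrow> bool" where
  "orthonormal_basis B \<longleftrightarrow> pairwise orthogonal B \<and> (\<forall>b\<in>B. norm b = 1) \<and> span B = UNIV"

lemma orthonormal_basis_Basis: "orthonormal_basis (Basis :: 'e::euclidean_space set)"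
  by (auto simp: orthonormal_basis_def pairwise_def orthogonal_def inner_Basis)

lemma finite_orthonormal_basis:
  assumes "orthonormal_basis B"
  shows "finite B"
proof -
  have "0 \<notin> B" using assms by (auto simp: orthonormal_basis_def)
  then show ?thesis
    using assms pairwise_orthogonal_independent independent_imp_finite
    by (auto simp: orthonormal_basis_def)
qed

lemma orthonormal_basis_inner:
  assumes "orthonormal_basis B" "b \<in> B" "c \<in> B"
  shows "b \<bullet> c = (if b = c then 1 else 0)"
  using assms by (auto simp: orthonormal_basis_def pairwise_def orthogonal_def norm_eq_1)

lemma orthonormal_basis_expansion:
  assumes B: "orthonormal_basis B"
  shows "(\<Sum>b\<in>B. (b \<bullet> x) *\<^sub>R b) = x"
proof -
  let ?y = "x - (\<Sum>b\<in>B. (b \<bullet> x) *\<^sub>R b)"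
  have fin: "finite B" by (rule finite_orthonormal_basis[OF B])
  have "orthogonal ?y c" if c: "c \<in> B" for c
  proof -
    have "(\<Sum>b\<in>B. (b \<bullet> x) *\<^sub>R b) \<bullet> c = (\<Sum>b\<in>B. if b = c then c \<bullet> x else 0)"
      unfolding inner_sum_left by (rule sum.cong) (auto simp: orthonormal_basis_inner[OF B _ c])
    also have "\<dots> = c \<bullet> x" using fin c by simp
    finally show ?thesis by (simp add: orthogonal_def inner_diff_left inner_commute[of c x])
  qed
  moreover have "?y \<in> span B" using B by (simp add: orthonormal_basis_def)
  ultimately have "orthogonal ?y ?y" using orthogonal_to_span by blast
  then show ?thesis by (simp add: orthogonal_def)
qed

lemma orthonormal_basis_parseval:
  assumes "orthonormal_basis B"
  shows "(\<Sum>b\<in>B. (x \<bullet> b) * (b \<bullet> y)) = x \<bullet> y"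
proof -
  have "x \<bullet> y = x \<bullet> (\<Sum>b\<in>B. (b \<bullet> y) *\<^sub>R b)"
    by (simp add: orthonormal_basis_expansion[OF assms])
  then show ?thesis by (simp add: inner_sum_right mult.commute)
qed

text \<open>
  Basis independence of the trace: expand \<open>T b\<close> in the basis \<open>C\<close>, and then resum over \<open>B\<close>.
\<close>

lemma orthonormal_basis_trace_eq:
  assumes B: "orthonormal_basis B" and C: "orthonormal_basis C" and T: "linear T"
  shows "(\<Sum>b\<in>B. b \<bullet> T b) = (\<Sum>c\<in>C. c \<bullet> T c)"
proof -
  interpret linear T by (rule T)
  have "(\<Sum>b\<in>B. b \<bullet> T b) = (\<Sum>b\<in>B. \<Sum>c\<in>C. (b \<bullet> c) * (c \<bullet> T b))"
    by (simp add: orthonormal_basis_parseval[OF C])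
  also have "\<dots> = (\<Sum>c\<in>C. \<Sum>b\<in>B. (b \<bullet> c) * (c \<bullet> T b))"
    by (rule sum.swap)
  also have "\<dots> = (\<Sum>c\<in>C. c \<bullet> T (\<Sum>b\<in>B. (b \<bullet> c) *\<^sub>R b))"
    by (simp add: sum scaleR inner_sum_right)
  also have "\<dots> = (\<Sum>c\<in>C. c \<bullet> T c)"
    by (simp add: orthonormal_basis_expansion[OF B])
  finally show ?thesis .
qed

text \<open>
  A maximiser \<open>v\<close> of the quadratic form \<open>x \<bullet> T x\<close> on the unit sphere of \<open>S\<close> is an eigenvector: the form
  \<open>q\<close> below is nonnegative on \<open>S\<close> and vanishes at \<open>v\<close>, so its derivative at \<open>v\<close> in the direction
  \<open>w = T v - c v\<close>, which is \<open>-2 (w \<bullet> w)\<close>, must be zero.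
\<close>

lemma selfadjoint_has_eigenvector:
  fixes T :: "'e::euclidean_space \<Rightarrow> 'e"
  assumes T: "linear T" and sym: "\<And>x y. T x \<bullet> y = x \<bullet> T y"
    and S: "subspace S" and inv: "\<And>x. x \<in> S \<Longrightarrow> T x \<in> S" and nz: "S \<noteq> {0}"
  obtains v where "v \<in> S" "norm v = 1" "T v = (v \<bullet> T v) *\<^sub>R v"
proof -
  interpret linear T by (rule T)
  let ?K = "S \<inter> sphere 0 1"
  have "compact ?K"
    using closed_subspace[OF S] by (simp add: closed_Int_compact)
  moreover have "?K \<noteq> {}"
  proof -
    obtain x where x: "x \<in> S" "x \<noteq> 0" using nz S subspace_0 by blast
    then have "(1 / norm x) *\<^sub>R x \<in> ?K" using subspace_scale[OF S] by simp
    then show ?thesis by blast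
  qed
  moreover have "continuous_on ?K (\<lambda>x. x \<bullet> T x)"
    by (intro continuous_intros linear_continuous_on linear_conv_bounded_linear[THEN iffD1] T)
  ultimately obtain v where v: "v \<in> ?K" and vmax: "\<And>x. x \<in> ?K \<Longrightarrow> x \<bullet> T x \<le> v \<bullet> T v"
    using continuous_attains_sup by metis
  define c where "c = v \<bullet> T v"
  define q where "q = (\<lambda>x. c * (x \<bullet> x) - x \<bullet> T x)"
  have q_nonneg: "q x \<ge> 0" if "x \<in> S" for x
  proof (cases "x = 0")
    case False
    let ?u = "(1 / norm x) *\<^sub>R x"
    have "?u \<bullet> T ?u \<le> c" unfolding c_def
      using False that subspace_scale[OF S] by (intro vmax) simp
    then have "(x \<bullet> T x) / (norm x)\<^sup>2 \<le> c"
      by (simp add: scaleR power2_eq_square)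
    then show ?thesis
      using False by (simp add: q_def divide_le_eq power2_norm_eq_inner)
  qed (simp add: q_def)
  have vv: "v \<bullet> v = 1" using v by (simp add: norm_eq_1)
  define w where "w = T v - c *\<^sub>R v"
  have wS: "w \<in> S" unfolding w_def using v inv S by (auto intro: subspace_diff subspace_scale)
  have expand: "q (v + t *\<^sub>R w) = t\<^sup>2 * q w - 2 * t * (w \<bullet> w)" for t
  proof -
    have "w \<bullet> T v = w \<bullet> w + c * (w \<bullet> v)"
      by (simp add: w_def inner_diff_right algebra_simps)
    moreover have "v \<bullet> T w = w \<bullet> T v" using sym[of v w] by (simp add: inner_commute)
    ultimately show ?thesis
      by (simp add: q_def add scaleR inner_add_left inner_add_right vv c_def[symmetric]
          power2_eq_square inner_commute[of v w] algebra_simps)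
  qed
  have "w \<bullet> w = 0"
  proof (rule ccontr)
    assume "w \<bullet> w \<noteq> 0"
    then have pos: "w \<bullet> w > 0" by (simp add: order_less_le)
    have ineq: "t\<^sup>2 * q w - 2 * t * (w \<bullet> w) \<ge> 0" for t
      using q_nonneg[of "v + t *\<^sub>R w"] v wS S expand by (auto intro: subspace_add subspace_scale)
    \<comment> \<open>For this \<open>t\<close> the linear term dominates the quadratic one; the \<open>1\<close> covers \<open>q w = 0\<close>.\<close>
    define t where "t = (w \<bullet> w) / (q w + 1)"
    have qw: "q w \<ge> 0" by (rule q_nonneg[OF wS])
    have t: "t > 0" "t * (q w + 1) = w \<bullet> w" using pos qw by (auto simp: t_def)
    have "t * q w \<le> w \<bullet> w" using t by (simp add: algebra_simps)
    then have "t * (t * q w) \<le> t * (w \<bullet> w)" using t by (simp add: mult_left_mono)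
    then have "t\<^sup>2 * q w - 2 * t * (w \<bullet> w) \<le> - (t * (w \<bullet> w))"
      by (simp add: power2_eq_square)
    moreover have "t * (w \<bullet> w) > 0" using t pos by simp
    ultimately show False using ineq[of t] by linarith
  qed
  then have "T v = c *\<^sub>R v" by (simp add: w_def)
  then show ?thesis using that v by (auto simp: c_def)
qed

text \<open>
  Induction on the dimension: split off one eigenvector and continue in its orthogonal complement,
  which \<open>T\<close> leaves invariant.
\<close>

lemma selfadjoint_eigenbasis_subspace:
  fixes T :: "'e::euclidean_space \<Rightarrow> 'e"
  assumes T: "linear T" and sym: "\<And>x y. T x \<bullet> y = x \<bullet> T y"
    and "subspace S" and "\<And>x. x \<in> S \<Longrightarrow> T x \<in> S"
  shows "\<exists>B. pairwise orthogonal B \<and> (\<forall>b\<in>B. norm b = 1 \<and> T b = (b \<bullet> T b) *\<^sub>R b) \<and> span B = S"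
  using assms(3,4)
proof (induction "dim S" arbitrary: S rule: less_induct)
  case less
  note S = less.prems(1) and inv = less.prems(2)
  show ?case
  proof (cases "S = {0}")
    case True
    then show ?thesis by (intro exI[of _ "{}"]) auto
  next
    case False
    obtain v where v: "v \<in> S" "norm v = 1" "T v = (v \<bullet> T v) *\<^sub>R v"
      using selfadjoint_has_eigenvector[OF T sym S inv False] by blast
    define S' where "S' = {y \<in> S. orthogonal v y}"
    have S': "subspace S'"
      unfolding S'_def using S by (auto simp: subspace_def orthogonal_def inner_add_right)
    have inv': "T x \<in> S'" if "x \<in> S'" for x
    proof -
      have "v \<bullet> T x = (v \<bullet> T v) * (v \<bullet> x)"
        using sym[of v x] v(3) by (metis inner_scaleR_left)
      then show ?thesis using that inv by (auto simp: S'_def orthogonal_def)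
    qed
    have "v \<notin> S'" using v(2) by (auto simp: S'_def orthogonal_def norm_eq_1)
    then have "S' \<noteq> S" using v(1) by auto
    moreover have "S' \<subseteq> S" by (auto simp: S'_def)
    ultimately have "dim S' < dim S"
      using subspace_dim_equal[OF S' S] by (meson not_le)
    from less.hyps[OF this S' inv'] obtain B where
      B: "pairwise orthogonal B" "\<And>b. b \<in> B \<Longrightarrow> norm b = 1 \<and> T b = (b \<bullet> T b) *\<^sub>R b" "span B = S'"
      by blast
    have orth: "orthogonal v b" if "b \<in> B" for b
      using that B(3) span_base by (fastforce simp: S'_def)
    have "span (insert v B) = S"
    proof
      show "span (insert v B) \<subseteq> S"
        using v(1) B(3) S span_superset[of B] by (intro span_minimal) (auto simp: S'_def)
      show "S \<subseteq> span (insert v B)"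
      proof
        fix x assume x: "x \<in> S"
        have "x - (v \<bullet> x) *\<^sub>R v \<in> S'"
          using x v S by (auto simp: S'_def orthogonal_def inner_diff_right norm_eq_1
              intro: subspace_diff subspace_scale)
        then show "x \<in> span (insert v B)"
          unfolding span_insert using B(3) by blast
      qed
    qed
    moreover have "pairwise orthogonal (insert v B)"
      using B(1) orth by (auto simp: pairwise_insert orthogonal_commute)
    ultimately show ?thesis
      using v(2,3) B(2) by (intro exI[of _ "insert v B"]) auto
  qed
qed

lemma selfadjoint_eigenbasis:
  fixes T :: "'e::euclidean_space \<Rightarrow> 'e"
  assumes "linear T" and "\<And>x y. T x \<bullet> y = x \<bullet> T y"
  obtains B where "orthonormal_basis B" "\<And>b. b \<in> B \<Longrightarrow> T b = (b \<bullet> T b) *\<^sub>R b"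
  using selfadjoint_eigenbasis_subspace[OF assms subspace_UNIV] by (auto simp: orthonormal_basis_def)

section \<open>Hermitian matrices\<close>

lemma linear_matrix_vector: "linear (\<lambda>x. (A :: complex^'d^'d) *v x)"
  by (rule linearI)
    (simp_all add: vec_eq_iff matrix_vector_mult_def scaleR_sum_right distrib_left sum.distrib)

lemma bounded_linear_matrix_vector: "bounded_linear (\<lambda>x. (A :: complex^'d^'d) *v x)"
  using linear_matrix_vector linear_conv_bounded_linear by blast

lemma matrix_vector_scaleR_left: "(c *\<^sub>R A) *v x = c *\<^sub>R ((A :: complex^'d^'d) *v x)"
  by (simp add: vec_eq_iff matrix_vector_mult_def scaleR_sum_right)

lemma hermitian_mat_inner:
  assumes "hermitian_mat A"
  shows "(A *v x) \<bullet> y = x \<bullet> (A *v y)"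
proof -
  have entry: "(A $ i $ j * x $ j) \<bullet> y $ i = x $ j \<bullet> (A $ j $ i * y $ i)" for i j
  proof -
    have "A $ j $ i = cnj (A $ i $ j)" using assms unfolding hermitian_mat_def by blast
    then show ?thesis by (simp add: inner_complex_def algebra_simps)
  qed
  have "(A *v x) \<bullet> y = (\<Sum>i\<in>UNIV. \<Sum>j\<in>UNIV. (A $ i $ j * x $ j) \<bullet> y $ i)"
    by (simp add: inner_vec_def matrix_vector_mult_def inner_sum_left)
  also have "\<dots> = (\<Sum>j\<in>UNIV. \<Sum>i\<in>UNIV. x $ j \<bullet> (A $ j $ i * y $ i))"
    unfolding entry by (rule sum.swap)
  also have "\<dots> = x \<bullet> (A *v y)"
    by (simp add: inner_vec_def matrix_vector_mult_def inner_sum_right)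
  finally show ?thesis .
qed

text \<open>
  The factor \<open>2\<close> is the real dimension of \<open>\<complex>\<close>: the standard real basis contains \<open>axis i 1\<close> and
  \<open>axis i \<i>\<close>, and both contribute the real part of \<open>A $ i $ i\<close>.
\<close>

lemma Re_trace_orthonormal_basis:
  fixes A :: "complex^'d^'d"
  assumes "orthonormal_basis B"
  shows "2 * Re (trace A) = (\<Sum>b\<in>B. b \<bullet> (A *v b))"
proof -
  have entry: "axis i c \<bullet> (A *v axis i c) = Re (cnj c * (A $ i $ i * c))" for i c
  proof -
    have "(A *v axis i c) $ i = A $ i $ i * c"
      by (simp add: matrix_vector_mult_def axis_def if_distrib[of "(*) _"] cong: if_cong)
    then show ?thesis by (simp add: inner_axis' inner_complex_def)
  qed
  have "(\<Sum>b\<in>Basis. b \<bullet> (A *v b)) = (\<Sum>i\<in>UNIV. \<Sum>c\<in>Basis. axis i c \<bullet> (A *v axis i (c::complex)))"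
  proof -
    have Basis: "(Basis :: (complex^'d) set) = (\<lambda>(i, c). axis i c) ` (UNIV \<times> Basis)"
      by (auto simp: Basis_vec_def)
    have "inj_on (\<lambda>(i::'d, c::complex). axis i c) (UNIV \<times> Basis)"
      by (auto simp: inj_on_def axis_eq_axis)
    then show ?thesis
      unfolding Basis by (subst sum.reindex) (simp_all add: sum.cartesian_product case_prod_unfold)
  qed
  also have "\<dots> = (\<Sum>i\<in>UNIV. 2 * Re (A $ i $ i))"
    by (simp add: entry Basis_complex_def)
  also have "\<dots> = 2 * Re (trace A)" by (simp add: trace_def sum_distrib_left)
  finally show ?thesis
    using orthonormal_basis_trace_eq[OF assms orthonormal_basis_Basis linear_matrix_vector, of A] by simp
qed

definition eigenbasis :: "complex^'d^'d \<Rightarrow> (complex^'d) set \<Rightarrow> bool" where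
  "eigenbasis A B \<longleftrightarrow> orthonormal_basis B \<and> (\<forall>b\<in>B. A *v b = (b \<bullet> (A *v b)) *\<^sub>R b)"

lemma hermitian_eigenbasis:
  assumes "hermitian_mat A"
  obtains B where "eigenbasis A B"
  using selfadjoint_eigenbasis[OF linear_matrix_vector hermitian_mat_inner[OF assms]]
  by (metis eigenbasis_def)

abbreviation re_trace :: "complex^'d^'d \<Rightarrow> real" where
  "re_trace A \<equiv> Re (trace A)"

lemma bounded_linear_re_trace: "bounded_linear (re_trace :: complex^'d^'d \<Rightarrow> real)"
  by (intro linear_conv_bounded_linear[THEN iffD1] linearI)
    (simp_all add: trace_def sum.distrib sum_distrib_left)

lemma re_trace_scaleR: "re_trace (c *\<^sub>R A) = c * re_trace A"
  by (simp add: trace_def sum_distrib_left)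

lemma bounded_bilinear_matrix_mult:
  "bounded_bilinear ((**) :: complex^'d^'d \<Rightarrow> complex^'d^'d \<Rightarrow> complex^'d^'d)"
proof (intro bilinear_conv_bounded_bilinear[THEN iffD1])
  show "bilinear ((**) :: complex^'d^'d \<Rightarrow> complex^'d^'d \<Rightarrow> complex^'d^'d)"
    unfolding bilinear_def
    by (auto intro!: linearI simp: vec_eq_iff matrix_matrix_mult_def distrib_left distrib_right
        sum.distrib scaleR_sum_right)
qed

interpretation mmult: bounded_bilinear
  "(**) :: complex^'d^'d \<Rightarrow> complex^'d^'d \<Rightarrow> complex^'d^'d"
  by (rule bounded_bilinear_matrix_mult)

lemma bounded_linear_apply_vector: "bounded_linear (\<lambda>A. (A :: complex^'d^'d) *v x)"
  by (intro linear_conv_bounded_linear[THEN iffD1] linearI)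
    (simp_all add: matrix_vector_mult_add_rdistrib matrix_vector_scaleR_left)

lemma hermitian_matI: "(\<And>i j. cnj (A $ j $ i) = A $ i $ j) \<Longrightarrow> hermitian_mat A"
  unfolding hermitian_mat_def by (intro allI, rule sym)

lemma hermitian_matD: "hermitian_mat A \<Longrightarrow> cnj (A $ j $ i) = A $ i $ j"
  unfolding hermitian_mat_def by ((erule allE)+, erule sym)

lemma hermitian_mat_scaleR: "hermitian_mat A \<Longrightarrow> hermitian_mat (c *\<^sub>R A)"
  by (rule hermitian_matI) (simp add: hermitian_matD)

lemma hermitian_mat_diff: "hermitian_mat A \<Longrightarrow> hermitian_mat B \<Longrightarrow> hermitian_mat (A - B)"
  by (rule hermitian_matI) (simp add: hermitian_matD)

lemma hermitian_mat_square_inner: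
  assumes "hermitian_mat A"
  shows "x \<bullet> ((A ** A) *v x) = (norm (A *v x))\<^sup>2"
  using hermitian_mat_inner[OF assms, of x "A *v x"]
  by (simp add: power2_norm_eq_inner matrix_vector_mul_assoc)

lemma card_orthonormal_basis:
  fixes B :: "(complex^'d) set"
  assumes "orthonormal_basis B"
  shows "card B = 2 * CARD('d)"
proof -
  have "independent B"
    using assms by (intro pairwise_orthogonal_independent) (auto simp: orthonormal_basis_def)
  moreover have "span B = UNIV" using assms by (simp add: orthonormal_basis_def)
  ultimately have "card B = dim (UNIV :: (complex^'d) set)"
    by (metis dim_span_eq_card_independent)
  then show ?thesis by (simp add: dim_UNIV)
qed

lemma eigenbasis_orthonormal: "eigenbasis A B \<Longrightarrow> orthonormal_basis B"
  by (simp add: eigenbasis_def)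

lemma eigenbasis_apply: "eigenbasis A B \<Longrightarrow> b \<in> B \<Longrightarrow> A *v b = (b \<bullet> (A *v b)) *\<^sub>R b"
  by (simp add: eigenbasis_def)

section \<open>The matrix exponential\<close>

primrec mat_pow :: "complex^'d^'d \<Rightarrow> nat \<Rightarrow> complex^'d^'d" where
  "mat_pow A 0 = mat 1"
| "mat_pow A (Suc k) = A ** mat_pow A k"

definition mat_exp :: "complex^'d^'d \<Rightarrow> complex^'d^'d" where
  "mat_exp A = (\<Sum>k. (1 / fact k) *\<^sub>R mat_pow A k)"

text \<open>
  Comparison with the exponential series: bilinearity of the product gives
  \<open>norm (A ** B) \<le> K * norm A * norm B\<close> for some \<open>K\<close>, so the powers grow at most geometrically.
\<close>

lemma mat_exp_norm_bound:
  obtains C K :: real where "C \<ge> 0" "K \<ge> 0"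
    and "\<And>A :: complex^'d^'d. summable (\<lambda>k. norm ((1 / fact k) *\<^sub>R mat_pow A k))"
    and "\<And>A :: complex^'d^'d. norm (mat_exp A) \<le> C * exp (K * norm A)"
proof -
  obtain K where K: "K > 0" "\<And>A B. norm ((A :: complex^'d^'d) ** (B :: complex^'d^'d)) \<le> norm A * norm B * K"
    using mmult.pos_bounded by blast
  define C where "C = norm (mat 1 :: complex^'d^'d)"
  have pow: "norm (mat_pow A k) \<le> C * (K * norm A) ^ k" for A :: "complex^'d^'d" and k
  proof (induction k)
    case (Suc k)
    have "norm (mat_pow A (Suc k)) \<le> norm A * norm (mat_pow A k) * K" using K(2) by simp
    also have "\<dots> \<le> norm A * (C * (K * norm A) ^ k) * K"
      using Suc K(1) by (intro mult_right_mono mult_left_mono) auto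
    finally show ?case by (simp add: mult_ac)
  qed (simp add: C_def)
  have summand: "norm ((1 / fact k) *\<^sub>R mat_pow A k) \<le> C * ((K * norm A) ^ k /\<^sub>R fact k)"
    for A :: "complex^'d^'d" and k
    using pow[of A k] by (simp add: divide_right_mono field_simps)
  have sums: "(\<lambda>k. C * ((K * norm A) ^ k /\<^sub>R fact k)) sums (C * exp (K * norm A))"
    for A :: "complex^'d^'d"
    by (intro sums_mult exp_converges)
  have summ: "summable (\<lambda>k. norm ((1 / fact k) *\<^sub>R mat_pow A k))" for A :: "complex^'d^'d"
    by (rule summable_comparison_test'[OF sums_summable[OF sums[of A]], where N = 0])
      (simp only: real_norm_def abs_norm_cancel summand)
  have "norm (mat_exp A) \<le> C * exp (K * norm A)" for A :: "complex^'d^'d"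
  proof -
    have "norm (mat_exp A) \<le> (\<Sum>k. norm ((1 / fact k) *\<^sub>R mat_pow A k))"
      unfolding mat_exp_def by (rule summable_norm[OF summ])
    also have "\<dots> \<le> (\<Sum>k. C * ((K * norm A) ^ k /\<^sub>R fact k))"
      by (intro suminf_le summand summ sums_summable[OF sums])
    also have "\<dots> = C * exp (K * norm A)" using sums[of A] by (simp add: sums_iff)
    finally show ?thesis .
  qed
  then show ?thesis using that[of C K] K(1) summ by (auto simp: C_def)
qed

lemma mat_pow_eigenvector:
  assumes "A *v u = a *\<^sub>R u"
  shows "mat_pow A k *v u = a ^ k *\<^sub>R u"
proof (induction k)
  case (Suc k)
  have "mat_pow A (Suc k) *v u = A *v (a ^ k *\<^sub>R u)"
    by (simp add: matrix_vector_mul_assoc[symmetric] Suc)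
  also have "\<dots> = a ^ Suc k *\<^sub>R u"
    using linear_scale[OF linear_matrix_vector, of A "a ^ k" u] assms by (simp add: mult.commute)
  finally show ?case .
qed simp

lemma mat_exp_eigenvector:
  assumes "A *v u = a *\<^sub>R u"
  shows "mat_exp A *v u = exp a *\<^sub>R u"
proof -
  have "summable (\<lambda>k. norm ((1 / fact k) *\<^sub>R mat_pow A k))"
    by (rule mat_exp_norm_bound[where ?'d = 'a]) blast
  then have summ: "summable (\<lambda>k. (1 / fact k) *\<^sub>R mat_pow A k)" by (rule summable_norm_cancel)
  have "mat_exp A *v u = (\<Sum>k. ((1 / fact k) *\<^sub>R mat_pow A k) *v u)"
    unfolding mat_exp_def by (rule bounded_linear.suminf[OF bounded_linear_apply_vector summ])
  also have "\<dots> = (\<Sum>k. (a ^ k /\<^sub>R fact k) *\<^sub>R u)"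
    by (simp add: matrix_vector_scaleR_left mat_pow_eigenvector[OF assms] field_simps)
  also have "\<dots> = exp a *\<^sub>R u"
    using exp_converges[of a]
    by (simp add: sums_iff bounded_linear.suminf[OF bounded_linear_scaleR_left, symmetric])
  finally show ?thesis .
qed

lemma borel_measurable_matrix_mult [measurable]:
  fixes F G :: "'a \<Rightarrow> complex^'d^'d"
  assumes "F \<in> borel_measurable M" "G \<in> borel_measurable M"
  shows "(\<lambda>x. F x ** G x) \<in> borel_measurable M"
  by (rule borel_measurable_continuous_Pair[OF assms])
    (intro mmult.continuous_on continuous_on_fst continuous_on_snd continuous_on_id)

lemma borel_measurable_mat_exp [measurable]:
  fixes F :: "'a \<Rightarrow> complex^'d^'d"
  assumes [measurable]: "F \<in> borel_measurable M"
  shows "(\<lambda>x. mat_exp (F x)) \<in> borel_measurable M"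
proof -
  have [measurable]: "(\<lambda>x. mat_pow (F x) k) \<in> borel_measurable M" for k
    by (induction k) simp_all
  show ?thesis unfolding mat_exp_def by measurable
qed

text \<open>
  All traces against matrix exponentials are evaluated through this formula; it reduces them to scalar
  inequalities for the eigenvalues \<open>b \<bullet> (A *v b)\<close>.
\<close>

lemma re_trace_mult_mat_exp:
  assumes "eigenbasis A B"
  shows "2 * re_trace (S ** mat_exp (t *\<^sub>R A)) = (\<Sum>b\<in>B. exp (t * (b \<bullet> (A *v b))) * (b \<bullet> (S *v b)))"
proof -
  have "b \<bullet> ((S ** mat_exp (t *\<^sub>R A)) *v b) = exp (t * (b \<bullet> (A *v b))) * (b \<bullet> (S *v b))"
    if "b \<in> B" for b
  proof -
    have "(t *\<^sub>R A) *v b = (t * (b \<bullet> (A *v b))) *\<^sub>R b"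
      using eigenbasis_apply[OF assms that] by (metis matrix_vector_scaleR_left scaleR_scaleR)
    from mat_exp_eigenvector[OF this] show ?thesis
      by (simp add: matrix_vector_mul_assoc[symmetric] linear_scale[OF linear_matrix_vector])
  qed
  then show ?thesis
    by (simp add: Re_trace_orthonormal_basis[OF eigenbasis_orthonormal[OF assms]])
qed

lemma re_trace_mat_exp:
  assumes "eigenbasis A B"
  shows "2 * re_trace (mat_exp (t *\<^sub>R A)) = (\<Sum>b\<in>B. exp (t * (b \<bullet> (A *v b))))"
proof -
  have "b \<bullet> b = 1" if "b \<in> B" for b
    using orthonormal_basis_inner[OF eigenbasis_orthonormal[OF assms] that that] by simp
  then show ?thesis using re_trace_mult_mat_exp[OF assms, of "mat 1" t] by simp
qed

lemma re_trace_mult_mat_exp_mono: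
  assumes A: "hermitian_mat A" and le: "\<And>x. x \<bullet> (S *v x) \<le> x \<bullet> (S' *v x)"
  shows "re_trace (S ** mat_exp A) \<le> re_trace (S' ** mat_exp A)"
proof -
  obtain B where B: "eigenbasis A B" using hermitian_eigenbasis[OF A] .
  have "2 * re_trace (S ** mat_exp A) \<le> 2 * re_trace (S' ** mat_exp A)"
    using re_trace_mult_mat_exp[OF B, of S 1] re_trace_mult_mat_exp[OF B, of S' 1]
    by (simp add: sum_mono mult_left_mono le)
  then show ?thesis by simp
qed

lemma re_trace_mat_exp_nonneg:
  assumes A: "hermitian_mat A"
  shows "0 \<le> re_trace (mat_exp A)"
  using re_trace_mult_mat_exp_mono[OF A, of 0 "mat 1"] by (simp add: mmult.zero_left trace_def)

lemma re_trace_mat_exp_0: "re_trace (mat_exp (0 :: complex^'d^'d)) = real CARD('d)"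
proof -
  obtain B where B: "eigenbasis (0 :: complex^'d^'d) B"
    using hermitian_eigenbasis[of 0] by (auto simp: hermitian_mat_def)
  show ?thesis
    using re_trace_mat_exp[OF B, of 0] card_orthonormal_basis[OF eigenbasis_orthonormal[OF B]] by simp
qed

text \<open>
  Convexity of the exponential: \<open>exp x + (y - x) exp y \<ge> exp y\<close>, applied to each eigenvalue. Integrated, it
  replaces differentiation of the moment generating function under the integral sign.
\<close>

lemma re_trace_mat_exp_step:
  assumes A: "hermitian_mat A"
  shows "re_trace (mat_exp ((\<theta> + h) *\<^sub>R A))
    \<le> re_trace (mat_exp (\<theta> *\<^sub>R A)) + h * re_trace (A ** mat_exp ((\<theta> + h) *\<^sub>R A))"
proof -
  obtain B where B: "eigenbasis A B" using hermitian_eigenbasis[OF A] .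
  have *: "exp ((\<theta> + h) * a) \<le> exp (\<theta> * a) + h * (exp ((\<theta> + h) * a) * a)" for a
  proof -
    have "exp ((\<theta> + h) * a) * (1 + (- h * a)) \<le> exp ((\<theta> + h) * a) * exp (- h * a)"
      using exp_ge_add_one_self[of "- h * a"] by (intro mult_left_mono) auto
    also have "\<dots> = exp (\<theta> * a)" by (simp add: mult_exp_exp algebra_simps)
    finally show ?thesis by (simp add: algebra_simps)
  qed
  have "2 * re_trace (mat_exp ((\<theta> + h) *\<^sub>R A))
      \<le> 2 * re_trace (mat_exp (\<theta> *\<^sub>R A)) + h * (2 * re_trace (A ** mat_exp ((\<theta> + h) *\<^sub>R A)))"
    unfolding re_trace_mat_exp[OF B] re_trace_mult_mat_exp[OF B] sum_distrib_left sum.distrib[symmetric]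
    using * by (intro sum_mono)
  then show ?thesis by simp
qed

text \<open>
  The logarithmic mean is at most the arithmetic mean. After division by \<open>exp y\<close> the claim for \<open>y \<le> x\<close>
  becomes \<open>exp t - 1 \<le> t (exp t + 1) / 2\<close> with \<open>t = x - y\<close>, which holds at \<open>0\<close> and is preserved because
  \<open>exp t (1 - t) \<le> 1\<close>.
\<close>

lemma exp_log_mean_le:
  fixes a b :: real
  shows "\<bar>exp a - exp b\<bar> \<le> \<bar>a - b\<bar> * (exp a + exp b) / 2"
proof -
  have main: "exp x - exp y \<le> (x - y) * (exp x + exp y) / 2" if "y \<le> x" for x y :: real
  proof -
    let ?g = "\<lambda>t::real. t * (exp t + 1) / 2 - (exp t - 1)"
    have "?g 0 \<le> ?g (x - y)"
    proof (rule DERIV_nonneg_imp_nondecreasing[where f = ?g])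
      fix t :: real assume "0 \<le> t" "t \<le> x - y"
      have "exp t * (1 - t) \<le> exp t * exp (- t)"
        using exp_ge_add_one_self[of "- t"] by (intro mult_left_mono) auto
      then have "(exp t + 1 + t * exp t) / 2 - exp t \<ge> 0"
        by (simp add: mult_exp_exp algebra_simps)
      moreover have "(?g has_real_derivative (exp t + 1 + t * exp t) / 2 - exp t) (at t)"
        by (auto intro!: derivative_eq_intros simp: field_simps)
      ultimately show "\<exists>y. (?g has_real_derivative y) (at t) \<and> 0 \<le> y" by blast
    qed (use that in simp)
    then have "0 \<le> ?g (x - y)" by simp
    then have "0 \<le> exp y * ?g (x - y)" by simp
    also have "exp y * ?g (x - y) = (x - y) * (exp x + exp y) / 2 - (exp x - exp y)"
      by (simp add: exp_diff field_simps)
    finally show ?thesis by simp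
  qed
  show ?thesis using main[of a b] main[of b a] by (cases "a \<le> b") (auto simp: abs_if algebra_simps)
qed

text \<open>
  The mean value trace inequality. Let \<open>u\<close> and \<open>w\<close> run through eigenbases of \<open>A\<close> and \<open>B\<close> with eigenvalues
  \<open>a u\<close> and \<open>b w\<close>. Both sides are double sums over \<open>u\<close> and \<open>w\<close>; the left one has the terms
  \<open>(exp (a u) - exp (b w)) (u \<bullet> w) (w \<bullet> C u)\<close>. The logarithmic mean inequality turns the first factor
  into \<open>(exp (a u) + exp (b w)) / 2\<close> times \<open>a u - b w\<close>, and \<open>(a u - b w) (u \<bullet> w) = w \<bullet> (A - B) u\<close>.
  It remains to apply \<open>2 x y \<le> s x\<^sup>2 + y\<^sup>2 / s\<close> term by term.
\<close>

lemma re_trace_exp_difference: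
  assumes A: "hermitian_mat A" and B: "hermitian_mat B" and C: "hermitian_mat C" and s: "s > 0"
  shows "re_trace (C ** (mat_exp A - mat_exp B))
    \<le> 1 / 4 * re_trace ((s *\<^sub>R ((A - B) ** (A - B)) + (1 / s) *\<^sub>R (C ** C)) ** (mat_exp A + mat_exp B))"
    (is "_ \<le> 1 / 4 * re_trace (?P ** _)")
proof -
  obtain U where U: "eigenbasis A U" using hermitian_eigenbasis[OF A] .
  obtain W where W: "eigenbasis B W" using hermitian_eigenbasis[OF B] .
  note ou = eigenbasis_orthonormal[OF U] and ow = eigenbasis_orthonormal[OF W]
  note D = hermitian_mat_diff[OF A B]
  define a where "a = (\<lambda>u. u \<bullet> (A *v u))"
  define b where "b = (\<lambda>w. w \<bullet> (B *v w))"
  have trA: "2 * re_trace (S ** mat_exp A) = (\<Sum>u\<in>U. exp (a u) * (u \<bullet> (S *v u)))" for S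
    using re_trace_mult_mat_exp[OF U, of S 1] by (simp add: a_def)
  have trB: "2 * re_trace (S ** mat_exp B) = (\<Sum>w\<in>W. exp (b w) * (w \<bullet> (S *v w)))" for S
    using re_trace_mult_mat_exp[OF W, of S 1] by (simp add: b_def)
  have expU: "x \<bullet> y = (\<Sum>u\<in>U. (x \<bullet> u) * (u \<bullet> y))" for x y
    by (rule orthonormal_basis_parseval[OF ou, symmetric])
  have expW: "x \<bullet> y = (\<Sum>w\<in>W. (x \<bullet> w) * (w \<bullet> y))" for x y
    by (rule orthonormal_basis_parseval[OF ow, symmetric])
  have symm: "u \<bullet> (S *v w) = w \<bullet> (S *v u)" if "hermitian_mat S" for S and u w
    using hermitian_mat_inner[OF that, of u w] by (simp add: inner_commute)
  have left: "2 * re_trace (C ** (mat_exp A - mat_exp B))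
      = (\<Sum>u\<in>U. \<Sum>w\<in>W. (exp (a u) - exp (b w)) * ((u \<bullet> w) * (w \<bullet> (C *v u))))"
  proof -
    have "(\<Sum>u\<in>U. exp (a u) * (u \<bullet> (C *v u)))
        = (\<Sum>u\<in>U. \<Sum>w\<in>W. exp (a u) * ((u \<bullet> w) * (w \<bullet> (C *v u))))"
      by (subst expW) (simp add: sum_distrib_left)
    moreover have "(\<Sum>w\<in>W. exp (b w) * (w \<bullet> (C *v w)))
        = (\<Sum>u\<in>U. \<Sum>w\<in>W. exp (b w) * ((u \<bullet> w) * (w \<bullet> (C *v u))))"
      by (subst expU, subst sum.swap)
        (simp add: sum_distrib_left symm[OF C] inner_commute[of _ "_ :: complex^'a"])
    ultimately show ?thesis
      by (simp add: mmult.diff_right trace_sub right_diff_distrib trA trB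
          sum_subtractf left_diff_distrib)
  qed
  have square: "x \<bullet> (?P *v x) = s * (norm ((A - B) *v x))\<^sup>2 + (norm (C *v x))\<^sup>2 / s" for x
    by (simp add: matrix_vector_mult_add_rdistrib matrix_vector_scaleR_left inner_add_right
        hermitian_mat_square_inner[OF D] hermitian_mat_square_inner[OF C])
  have normW: "(norm (S *v u))\<^sup>2 = (\<Sum>w\<in>W. (w \<bullet> (S *v u))\<^sup>2)" for S :: "complex^'a^'a" and u
    unfolding power2_norm_eq_inner by (subst expW) (simp add: power2_eq_square inner_commute)
  have normU: "(norm (S *v w))\<^sup>2 = (\<Sum>u\<in>U. (w \<bullet> (S *v u))\<^sup>2)" if "hermitian_mat S" for S w
    unfolding power2_norm_eq_inner
    by (subst expU) (simp add: power2_eq_square inner_commute symm[OF that])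
  have right: "2 * re_trace (?P ** (mat_exp A + mat_exp B))
      = (\<Sum>u\<in>U. \<Sum>w\<in>W. (exp (a u) + exp (b w)) *
          (s * (w \<bullet> ((A - B) *v u))\<^sup>2 + (w \<bullet> (C *v u))\<^sup>2 / s))"
  proof -
    have "(\<Sum>u\<in>U. exp (a u) * (u \<bullet> (?P *v u)))
        = (\<Sum>u\<in>U. \<Sum>w\<in>W. exp (a u) * (s * (w \<bullet> ((A - B) *v u))\<^sup>2 + (w \<bullet> (C *v u))\<^sup>2 / s))"
      unfolding square normW by (simp add: sum_distrib_left sum_divide_distrib flip: sum.distrib)
    moreover have "(\<Sum>w\<in>W. exp (b w) * (w \<bullet> (?P *v w)))
        = (\<Sum>u\<in>U. \<Sum>w\<in>W. exp (b w) * (s * (w \<bullet> ((A - B) *v u))\<^sup>2 + (w \<bullet> (C *v u))\<^sup>2 / s))"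
      unfolding square normU[OF D] normU[OF C]
      by (subst sum.swap) (simp add: sum_distrib_left sum_divide_distrib flip: sum.distrib)
    moreover have "2 * re_trace (?P ** (mat_exp A + mat_exp B))
        = (\<Sum>u\<in>U. exp (a u) * (u \<bullet> (?P *v u))) + (\<Sum>w\<in>W. exp (b w) * (w \<bullet> (?P *v w)))"
      by (simp only: mmult.add_right trace_add plus_complex.sel distrib_left trA trB)
    ultimately show ?thesis
      by (simp only: distrib_right sum.distrib)
  qed
  have "(exp (a u) - exp (b w)) * ((u \<bullet> w) * (w \<bullet> (C *v u)))
      \<le> 1 / 4 * ((exp (a u) + exp (b w)) *
          (s * (w \<bullet> ((A - B) *v u))\<^sup>2 + (w \<bullet> (C *v u))\<^sup>2 / s))" if u: "u \<in> U" and w: "w \<in> W" for u w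
  proof -
    define x where "x = w \<bullet> ((A - B) *v u)"
    define y where "y = w \<bullet> (C *v u)"
    have x: "x = (a u - b w) * (u \<bullet> w)"
    proof -
      have "w \<bullet> (A *v u) = a u * (w \<bullet> u)"
        using eigenbasis_apply[OF U u] unfolding a_def by (metis inner_scaleR_right)
      moreover have "w \<bullet> (B *v u) = b w * (w \<bullet> u)"
        using eigenbasis_apply[OF W w] symm[OF B, of w u] unfolding b_def
        by (metis inner_scaleR_right inner_commute)
      ultimately show ?thesis
        by (simp add: x_def matrix_vector_mult_diff_rdistrib inner_diff_right inner_commute
            left_diff_distrib)
    qed
    have xy: "\<bar>x\<bar> * \<bar>y\<bar> \<le> (s * x\<^sup>2 + y\<^sup>2 / s) / 2"
    proof -
      have "0 \<le> (s * \<bar>x\<bar> - \<bar>y\<bar>)\<^sup>2 / s" using s by simp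
      also have "\<dots> = s * x\<^sup>2 + y\<^sup>2 / s - 2 * (\<bar>x\<bar> * \<bar>y\<bar>)"
        using s by (simp add: power2_diff power_mult_distrib diff_divide_distrib add_divide_distrib)
          (simp add: power2_eq_square)
      finally show ?thesis by simp
    qed
    have "(exp (a u) - exp (b w)) * ((u \<bullet> w) * y) \<le> \<bar>exp (a u) - exp (b w)\<bar> * (\<bar>u \<bullet> w\<bar> * \<bar>y\<bar>)"
      by (metis abs_ge_self abs_mult)
    also have "\<dots> \<le> (\<bar>a u - b w\<bar> * (exp (a u) + exp (b w)) / 2) * (\<bar>u \<bullet> w\<bar> * \<bar>y\<bar>)"
      by (intro mult_right_mono exp_log_mean_le) auto
    also have "\<dots> = (exp (a u) + exp (b w)) / 2 * (\<bar>x\<bar> * \<bar>y\<bar>)"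
      by (simp add: x abs_mult)
    also have "\<dots> \<le> (exp (a u) + exp (b w)) / 2 * ((s * x\<^sup>2 + y\<^sup>2 / s) / 2)"
      by (intro mult_left_mono xy) (simp add: add_nonneg_nonneg)
    finally show ?thesis by (simp add: x_def y_def)
  qed
  then have "2 * re_trace (C ** (mat_exp A - mat_exp B))
      \<le> 1 / 4 * (2 * re_trace (?P ** (mat_exp A + mat_exp B)))"
    unfolding left right sum_distrib_left by (intro sum_mono) simp
  then show ?thesis by simp
qed

section \<open>Eigenvalues\<close>

lemma is_eigenvalue_of_real:
  "is_eigenvalue A (complex_of_real r) \<longleftrightarrow> (\<exists>x. x \<noteq> 0 \<and> A *v x = r *\<^sub>R x)"
  by (simp add: is_eigenvalue_def vec_eq_iff scaleR_conv_of_real[where 'a = complex])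

lemma is_eigenvalue_uminus:
  "is_eigenvalue (- A) (complex_of_real (- r)) \<longleftrightarrow> is_eigenvalue A (complex_of_real r)"
proof -
  have "(- A) *v x = - (A *v x)" for x
    by (simp add: vec_eq_iff matrix_vector_mult_def sum_negf)
  then show ?thesis unfolding is_eigenvalue_of_real by simp
qed

lemma eigenbasis_coefficient:
  assumes B: "eigenbasis A B" and A: "hermitian_mat A" and x: "A *v x = r *\<^sub>R x"
    and b: "b \<in> B" and ne: "b \<bullet> (A *v b) \<noteq> r"
  shows "b \<bullet> x = 0"
proof -
  have "r * (b \<bullet> x) = (A *v b) \<bullet> x"
    using hermitian_mat_inner[OF A, of b x] x by simp
  also have "\<dots> = (b \<bullet> (A *v b)) * (b \<bullet> x)"
    using eigenbasis_apply[OF B b] by (metis inner_scaleR_left)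
  finally show ?thesis using ne by simp
qed

lemma eigenvalues_hermitian:
  assumes A: "hermitian_mat A" and B: "eigenbasis A B"
  shows "{r. is_eigenvalue A (complex_of_real r)} = (\<lambda>b. b \<bullet> (A *v b)) ` B"
proof (intro set_eqI iffI)
  fix r assume "r \<in> {r. is_eigenvalue A (complex_of_real r)}"
  then obtain x where x: "x \<noteq> 0" "A *v x = r *\<^sub>R x" by (auto simp: is_eigenvalue_of_real)
  show "r \<in> (\<lambda>b. b \<bullet> (A *v b)) ` B"
  proof (rule ccontr)
    assume "r \<notin> (\<lambda>b. b \<bullet> (A *v b)) ` B"
    then have "b \<bullet> x = 0" if "b \<in> B" for b using eigenbasis_coefficient[OF B A x(2) that] that by auto
    then have "x = 0" using orthonormal_basis_expansion[OF eigenbasis_orthonormal[OF B], of x] by simp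
    with x show False by simp
  qed
next
  fix r assume "r \<in> (\<lambda>b. b \<bullet> (A *v b)) ` B"
  then obtain b where b: "b \<in> B" "r = b \<bullet> (A *v b)" by auto
  have "b \<noteq> 0" using b(1) eigenbasis_orthonormal[OF B] by (auto simp: orthonormal_basis_def)
  then show "r \<in> {r. is_eigenvalue A (complex_of_real r)}"
    using eigenbasis_apply[OF B b(1)] b by (auto simp: is_eigenvalue_of_real)
qed

lemma finite_nonempty_eigenvalues:
  fixes A :: "complex^'d^'d"
  assumes A: "hermitian_mat A"
  shows "finite {r. is_eigenvalue A (complex_of_real r)}" "{r. is_eigenvalue A (complex_of_real r)} \<noteq> {}"
proof -
  obtain B where B: "eigenbasis A B" using hermitian_eigenbasis[OF A] .
  have "card B > 0" using card_orthonormal_basis[OF eigenbasis_orthonormal[OF B]] by simp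
  then show "finite {r. is_eigenvalue A (complex_of_real r)}"
    "{r. is_eigenvalue A (complex_of_real r)} \<noteq> {}"
    unfolding eigenvalues_hermitian[OF A B] by (auto simp: card_gt_0_iff)
qed

text \<open>
  A complex eigenvector \<open>x\<close> and \<open>\<i> x\<close> are orthogonal over the reals, so each eigenvalue occurs at
  least twice in a real eigenbasis; this compensates the factor \<open>2\<close> in the trace formula. The count uses
  Bessel's inequality for the pair \<open>x\<close>, \<open>\<i> x\<close> at each basis vector.
\<close>

lemma exp_eigenvalue_le_re_trace:
  fixes A :: "complex^'d^'d"
  assumes A: "hermitian_mat A" and r: "is_eigenvalue A (complex_of_real r)"
  shows "exp (t * r) \<le> re_trace (mat_exp (t *\<^sub>R A))"
proof -
  obtain B where B: "eigenbasis A B" using hermitian_eigenbasis[OF A] .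
  note onb = eigenbasis_orthonormal[OF B]
  obtain x0 where x0: "x0 \<noteq> 0" "A *v x0 = r *\<^sub>R x0" using r by (auto simp: is_eigenvalue_of_real)
  define x where "x = (1 / norm x0) *\<^sub>R x0"
  define y where "y = \<i> *s x"
  have x: "norm x = 1" "A *v x = r *\<^sub>R x"
    using x0 by (simp_all add: x_def linear_scale[OF linear_matrix_vector])
  have y_inner: "y \<bullet> y = x \<bullet> x" "x \<bullet> y = 0"
    by (simp_all add: y_def inner_vec_def inner_complex_def add.commute)
  have Ay: "A *v y = r *\<^sub>R y"
    unfolding y_def using x(2)
    by (simp add: vec_eq_iff vector_scalar_commute scaleR_conv_of_real[where 'a = complex] mult.left_commute)
  have xx: "x \<bullet> x = 1" using x by (simp add: norm_eq_1)
  define B' where "B' = {b \<in> B. b \<bullet> (A *v b) = r}"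
  have finB: "finite B" by (rule finite_orthonormal_basis[OF onb])
  have bessel: "(b \<bullet> x)\<^sup>2 + (b \<bullet> y)\<^sup>2 \<le> 1" if "b \<in> B" for b
  proof -
    have bb: "b \<bullet> b = 1" using orthonormal_basis_inner[OF onb that that] by simp
    have "0 \<le> (b - (b \<bullet> x) *\<^sub>R x - (b \<bullet> y) *\<^sub>R y) \<bullet> (b - (b \<bullet> x) *\<^sub>R x - (b \<bullet> y) *\<^sub>R y)" by simp
    also have "\<dots> = 1 - (b \<bullet> x)\<^sup>2 - (b \<bullet> y)\<^sup>2"
      using y_inner xx bb
      by (simp add: inner_diff_left inner_diff_right inner_commute[of x b] inner_commute[of y b]
          inner_commute[of y x] power2_eq_square algebra_simps)
    finally show ?thesis by simp
  qed
  have sum1: "(\<Sum>b\<in>B'. (b \<bullet> z)\<^sup>2) = z \<bullet> z" if "A *v z = r *\<^sub>R z" for z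
  proof -
    have "z \<bullet> z = (\<Sum>b\<in>B. (b \<bullet> z)\<^sup>2)"
      using orthonormal_basis_parseval[OF onb, of z z] by (simp add: power2_eq_square inner_commute)
    also have "\<dots> = (\<Sum>b\<in>B'. (b \<bullet> z)\<^sup>2)"
      using finB eigenbasis_coefficient[OF B A that]
      by (intro sum.mono_neutral_right) (auto simp: B'_def)
    finally show ?thesis by simp
  qed
  have "2 = (\<Sum>b\<in>B'. (b \<bullet> x)\<^sup>2 + (b \<bullet> y)\<^sup>2)"
    using sum1[OF x(2)] sum1[OF Ay] y_inner xx by (simp add: sum.distrib)
  also have "\<dots> \<le> (\<Sum>b\<in>B'. 1)" by (intro sum_mono bessel) (simp add: B'_def)
  finally have card: "2 \<le> real (card B')" by simp
  have "2 * exp (t * r) \<le> real (card B') * exp (t * r)" using card by simp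
  also have "\<dots> = (\<Sum>b\<in>B'. exp (t * (b \<bullet> (A *v b))))" by (simp add: B'_def)
  also have "\<dots> \<le> (\<Sum>b\<in>B. exp (t * (b \<bullet> (A *v b))))"
    using finB by (intro sum_mono2) (auto simp: B'_def)
  also have "\<dots> = 2 * re_trace (mat_exp (t *\<^sub>R A))" by (rule re_trace_mat_exp[OF B, symmetric])
  finally show ?thesis by simp
qed

section \<open>Resampling coordinates of a product measure\<close>

text \<open>
  The result is extensional on \<open>J\<close>, as the points of a product space over \<open>J\<close> are.
\<close>

definition mix :: "'i set \<Rightarrow> 'i set \<Rightarrow> ('i \<Rightarrow> 'a) \<Rightarrow> ('i \<Rightarrow> 'a) \<Rightarrow> 'i \<Rightarrow> 'a" where
  "mix J S x y = (\<lambda>j\<in>J. if j \<in> S then y j else x j)"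

lemma measurable_mix [measurable]:
  "(\<lambda>p. mix J S (fst p) (snd p)) \<in> PiM J M \<Otimes>\<^sub>M PiM J M \<rightarrow>\<^sub>M PiM J M"
  unfolding mix_def
  by (rule measurable_restrict) (auto intro!: measurable_compose[OF measurable_fst] measurable_compose[OF measurable_snd])

lemma measurable_mix1 [measurable]:
  assumes "x \<in> space (PiM J M)"
  shows "mix J S x \<in> PiM J M \<rightarrow>\<^sub>M PiM J M"
  using measurable_Pair2[OF measurable_mix assms] by simp

lemma mix_in_space:
  assumes "x \<in> space (PiM J M)" "y \<in> space (PiM J M)"
  shows "mix J S x y \<in> space (PiM J M)"
  using measurable_space[OF measurable_mix1[OF assms(1)] assms(2)] .

text \<open>
  The fundamental fact about resampling: taking some coordinates from an independent copy does not
  change the law. The preimage of a box is a product of two boxes.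
\<close>

lemma distr_mix:
  assumes J: "finite J" and prob: "\<And>j. prob_space (M j)"
  shows "distr (PiM J M \<Otimes>\<^sub>M PiM J M) (PiM J M) (\<lambda>p. mix J S (fst p) (snd p)) = PiM J M"
proof -
  interpret product_prob_space M J by (intro product_prob_spaceI prob)
  interpret PP: pair_prob_space "PiM J M" "PiM J M" ..
  have sf: "sigma_finite_measure (PiM J M)" by unfold_locales
  show ?thesis
  proof (rule PiM_eqI[OF J])
    fix A assume A: "\<And>j. j \<in> J \<Longrightarrow> A j \<in> sets (M j)"
    let ?X = "Pi\<^sub>E J (\<lambda>j. if j \<in> S then space (M j) else A j)"
    let ?Y = "Pi\<^sub>E J (\<lambda>j. if j \<in> S then A j else space (M j))"
    have meas: "?X \<in> sets (PiM J M)" "?Y \<in> sets (PiM J M)" "Pi\<^sub>E J A \<in> sets (PiM J M)"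
      using J A by (auto intro!: sets_PiM_I_finite)
    have "(\<lambda>p. mix J S (fst p) (snd p)) -` Pi\<^sub>E J A \<inter> space (PiM J M \<Otimes>\<^sub>M PiM J M) = ?X \<times> ?Y"
    proof (intro set_eqI iffI)
      fix p assume p: "p \<in> (\<lambda>p. mix J S (fst p) (snd p)) -` Pi\<^sub>E J A \<inter> space (PiM J M \<Otimes>\<^sub>M PiM J M)"
      then have "\<forall>j\<in>J. (j \<in> S \<longrightarrow> snd p j \<in> A j) \<and> (j \<notin> S \<longrightarrow> fst p j \<in> A j)"
        by (auto simp: mix_def Pi_iff)
      then show "p \<in> ?X \<times> ?Y"
        using p by (auto simp: mem_Times_iff space_pair_measure space_PiM PiE_iff)
    next
      fix p assume p: "p \<in> ?X \<times> ?Y"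
      then have "\<forall>j\<in>J. (j \<in> S \<longrightarrow> snd p j \<in> A j) \<and> (j \<notin> S \<longrightarrow> fst p j \<in> A j)"
        by (auto simp: mem_Times_iff PiE_iff)
      moreover have "fst p j \<in> space (M j)" "snd p j \<in> space (M j)" if "j \<in> J" for j
        using p that A[THEN sets.sets_into_space, OF that]
        by (auto simp: mem_Times_iff PiE_iff split: if_splits)
      ultimately show "p \<in> (\<lambda>p. mix J S (fst p) (snd p)) -` Pi\<^sub>E J A \<inter> space (PiM J M \<Otimes>\<^sub>M PiM J M)"
        using p by (auto simp: mix_def mem_Times_iff space_pair_measure space_PiM PiE_iff)
    qed
    then have "emeasure (distr (PiM J M \<Otimes>\<^sub>M PiM J M) (PiM J M) (\<lambda>p. mix J S (fst p) (snd p))) (Pi\<^sub>E J A)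
        = emeasure (PiM J M) ?X * emeasure (PiM J M) ?Y"
      using meas by (simp add: emeasure_distr sigma_finite_measure.emeasure_pair_measure_Times[OF sf])
    also have "\<dots> = (\<Prod>j\<in>J. emeasure (M j) (if j \<in> S then space (M j) else A j)) *
        (\<Prod>j\<in>J. emeasure (M j) (if j \<in> S then A j else space (M j)))"
      using J A by (subst (1 2) emeasure_PiM) auto
    also have "\<dots> = (\<Prod>j\<in>J. emeasure (M j) (A j))"
      unfolding prod.distrib[symmetric] by (rule prod.cong) (auto simp: M.emeasure_space_1)
    finally show "emeasure (distr (PiM J M \<Otimes>\<^sub>M PiM J M) (PiM J M) (\<lambda>p. mix J S (fst p) (snd p))) (Pi\<^sub>E J A)
        = (\<Prod>j\<in>J. emeasure (M j) (A j))" .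
  qed simp
qed

lemma integral_mix:
  fixes g :: "('i \<Rightarrow> 'a) \<Rightarrow> 'b::{banach, second_countable_topology}"
  assumes J: "finite J" and prob: "\<And>j. prob_space (M j)" and g: "integrable (PiM J M) g"
  shows "integral\<^sup>L (PiM J M) g = (\<integral>x. (\<integral>y. g (mix J S x y) \<partial>PiM J M) \<partial>PiM J M)"
    and "integrable (PiM J M) (\<lambda>x. \<integral>y. g (mix J S x y) \<partial>PiM J M)"
proof -
  interpret product_prob_space M J by (intro product_prob_spaceI prob)
  interpret PP: pair_prob_space "PiM J M" "PiM J M" ..
  have sf: "sigma_finite_measure (PiM J M)" by unfold_locales
  have gm: "g \<in> borel_measurable (PiM J M)" using g by simp
  have int: "integrable (PiM J M \<Otimes>\<^sub>M PiM J M) (\<lambda>p. g (mix J S (fst p) (snd p)))"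
    using g integrable_distr_eq[OF measurable_mix gm, of S]
    by (simp add: distr_mix[OF J prob])
  then have "(\<integral>x. (\<integral>y. g (mix J S x y) \<partial>PiM J M) \<partial>PiM J M)
      = (\<integral>p. g (mix J S (fst p) (snd p)) \<partial>(PiM J M \<Otimes>\<^sub>M PiM J M))"
    using PP.integral_fst'[of "\<lambda>p. g (mix J S (fst p) (snd p))"] by simp
  also have "\<dots> = integral\<^sup>L (distr (PiM J M \<Otimes>\<^sub>M PiM J M) (PiM J M) (\<lambda>p. mix J S (fst p) (snd p))) g"
    by (simp add: integral_distr[OF measurable_mix gm])
  finally show "integral\<^sup>L (PiM J M) g = (\<integral>x. (\<integral>y. g (mix J S x y) \<partial>PiM J M) \<partial>PiM J M)"
    by (simp add: distr_mix[OF J prob])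
  show "integrable (PiM J M) (\<lambda>x. \<integral>y. g (mix J S x y) \<partial>PiM J M)"
    using PP.integrable_fst'[OF int] by simp
qed

lemma nn_integral_mix:
  assumes J: "finite J" and prob: "\<And>j. prob_space (M j)" and g: "g \<in> borel_measurable (PiM J M)"
  shows "integral\<^sup>N (PiM J M) g = (\<integral>\<^sup>+x. (\<integral>\<^sup>+y. g (mix J S x y) \<partial>PiM J M) \<partial>PiM J M)"
    and "(\<lambda>x. \<integral>\<^sup>+y. g (mix J S x y) \<partial>PiM J M) \<in> borel_measurable (PiM J M)"
proof -
  interpret product_prob_space M J by (intro product_prob_spaceI prob)
  interpret PP: pair_prob_space "PiM J M" "PiM J M" ..
  have sf: "sigma_finite_measure (PiM J M)" by unfold_locales
  have "integral\<^sup>N (PiM J M) g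
      = integral\<^sup>N (distr (PiM J M \<Otimes>\<^sub>M PiM J M) (PiM J M) (\<lambda>p. mix J S (fst p) (snd p))) g"
    by (simp add: distr_mix[OF J prob])
  also have "\<dots> = (\<integral>\<^sup>+p. g (mix J S (fst p) (snd p)) \<partial>(PiM J M \<Otimes>\<^sub>M PiM J M))"
    using nn_integral_distr[OF measurable_mix, of g J M S] g by simp
  also have "\<dots> = (\<integral>\<^sup>+x. (\<integral>\<^sup>+y. g (mix J S x y) \<partial>PiM J M) \<partial>PiM J M)"
    using measurable_compose[OF measurable_mix g]
      sigma_finite_measure.nn_integral_fst[OF sf, where f = "\<lambda>p. g (mix J S (fst p) (snd p))"] by simp
  finally show "integral\<^sup>N (PiM J M) g = (\<integral>\<^sup>+x. (\<integral>\<^sup>+y. g (mix J S x y) \<partial>PiM J M) \<partial>PiM J M)" .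
  show "(\<lambda>x. \<integral>\<^sup>+y. g (mix J S x y) \<partial>PiM J M) \<in> borel_measurable (PiM J M)"
    using sigma_finite_measure.borel_measurable_nn_integral_fst[OF sf measurable_compose[OF measurable_mix g]]
    by simp
qed

lemma AE_mix:
  assumes J: "finite J" and prob: "\<And>j. prob_space (M j)" and ae: "AE z in PiM J M. P z"
  shows "AE x in PiM J M. AE y in PiM J M. P (mix J S x y)"
proof -
  interpret product_prob_space M J by (intro product_prob_spaceI prob)
  interpret PP: pair_prob_space "PiM J M" "PiM J M" ..
  have sf: "sigma_finite_measure (PiM J M)" by unfold_locales
  have "AE z in distr (PiM J M \<Otimes>\<^sub>M PiM J M) (PiM J M) (\<lambda>p. mix J S (fst p) (snd p)). P z"
    unfolding distr_mix[OF J prob] by (rule ae)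
  from AE_distrD[OF measurable_mix this]
  have "AE p in PiM J M \<Otimes>\<^sub>M PiM J M. P (mix J S (fst p) (snd p))" .
  from PP.AE_pair[OF this] show ?thesis by simp
qed

lemma mix_singleton:
  assumes "i \<in> J" "x \<in> extensional J"
  shows "mix J {i} x y = x(i := y i)"
  using assms by (auto simp: mix_def fun_eq_iff extensional_def)

text \<open>
  The law of a pair \<open>(Z, Z')\<close> of independent copies, realised as one product measure whose coordinates
  are the pairs \<open>(i, False)\<close> (for \<open>Z\<close>) and \<open>(i, True)\<close> (for \<open>Z'\<close>). In this form both the partially
  resampled point \<open>Z\<^sup>R\<close>, which is \<open>copy I R\<close>, and the exchange of the two copies of one coordinate are
  reindexings, and reindexings preserve product measures.
\<close>

definition pairs_measure :: "'i set \<Rightarrow> ('i \<Rightarrow> 'a measure) \<Rightarrow> ('i \<times> bool \<Rightarrow> 'a) measure" where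
  "pairs_measure I M = PiM (I \<times> UNIV) (\<lambda>j. M (fst j))"

definition copy :: "'i set \<Rightarrow> 'i set \<Rightarrow> ('i \<times> bool \<Rightarrow> 'a) \<Rightarrow> 'i \<Rightarrow> 'a" where
  "copy I R \<omega> = (\<lambda>i\<in>I. \<omega> (i, i \<in> R))"

definition swap :: "'i set \<Rightarrow> 'i \<Rightarrow> ('i \<times> bool \<Rightarrow> 'a) \<Rightarrow> 'i \<times> bool \<Rightarrow> 'a" where
  "swap I i \<omega> = (\<lambda>j\<in>I \<times> UNIV. \<omega> (fst j, if fst j = i then \<not> snd j else snd j))"

lemma measurable_copy [measurable]: "copy I R \<in> pairs_measure I M \<rightarrow>\<^sub>M PiM I M"
  unfolding copy_def[abs_def] pairs_measure_def
proof (rule measurable_restrict)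
  fix i assume "i \<in> I"
  then show "(\<lambda>\<omega>. \<omega> (i, i \<in> R)) \<in> PiM (I \<times> UNIV) (\<lambda>j. M (fst j)) \<rightarrow>\<^sub>M M i"
    using measurable_component_singleton[of "(i, i \<in> R)" "I \<times> UNIV" "\<lambda>j. M (fst j)"] by simp
qed

lemma measurable_swap [measurable]: "swap I i \<in> pairs_measure I M \<rightarrow>\<^sub>M pairs_measure I M"
  unfolding swap_def[abs_def] pairs_measure_def
proof (rule measurable_restrict)
  fix j :: "'a \<times> bool" assume "j \<in> I \<times> UNIV"
  then show "(\<lambda>\<omega>. \<omega> (fst j, if fst j = i then \<not> snd j else snd j))
      \<in> PiM (I \<times> UNIV) (\<lambda>j. M (fst j)) \<rightarrow>\<^sub>M M (fst j)"
    using measurable_component_singleton[of "(fst j, if fst j = i then \<not> snd j else snd j)"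
        "I \<times> UNIV" "\<lambda>j. M (fst j)"] by (simp add: mem_Times_iff)
qed

lemma distr_copy:
  assumes prob: "\<And>i. prob_space (M i)"
  shows "distr (pairs_measure I M) (PiM I M) (copy I R) = PiM I M"
  using distr_PiM_reindex[of "I \<times> UNIV" "\<lambda>j. M (fst j)" "\<lambda>i. (i, i \<in> R)" I]
  by (simp add: pairs_measure_def copy_def[abs_def] prob inj_on_def)

lemma distr_swap:
  assumes prob: "\<And>i. prob_space (M i)"
  shows "distr (pairs_measure I M) (pairs_measure I M) (swap I i) = pairs_measure I M"
proof -
  let ?s = "\<lambda>j :: 'a \<times> bool. (fst j, if fst j = i then \<not> snd j else snd j)"
  have "inj_on ?s (I \<times> UNIV)"
    by (rule inj_on_inverseI[where g = ?s]) (simp add: prod_eq_iff)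
  moreover have "?s \<in> I \<times> UNIV \<rightarrow> I \<times> UNIV" by (simp add: Pi_iff mem_Times_iff)
  ultimately show ?thesis
    using distr_PiM_reindex[of "I \<times> UNIV" "\<lambda>j. M (fst j)" ?s "I \<times> UNIV"]
    unfolding pairs_measure_def swap_def[abs_def] by (simp only: prob fst_conv)
qed

lemma copy_swap:
  assumes "i \<in> I"
  shows "copy I R (swap I i \<omega>) = copy I (if i \<in> R then R - {i} else insert i R) \<omega>"
  using assms by (auto simp: copy_def swap_def restrict_def fun_eq_iff)

lemma prob_space_pairs_measure:
  assumes prob: "\<And>i. prob_space (M i)"
  shows "prob_space (pairs_measure I M)"
  unfolding pairs_measure_def by (rule prob_space_PiM) (rule prob)

section \<open>Bounded measurable functions\<close>

definition bounded_measurable :: "'a measure \<Rightarrow> ('a \<Rightarrow> 'b::real_normed_vector) \<Rightarrow> bool" where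
  "bounded_measurable N F \<longleftrightarrow> F \<in> borel_measurable N \<and> (\<exists>K. \<forall>x\<in>space N. norm (F x) \<le> K)"

lemma bounded_measurableI:
  "F \<in> borel_measurable N \<Longrightarrow> (\<And>x. x \<in> space N \<Longrightarrow> norm (F x) \<le> K) \<Longrightarrow> bounded_measurable N F"
  by (auto simp: bounded_measurable_def)

lemma bounded_measurable_borel: "bounded_measurable N F \<Longrightarrow> F \<in> borel_measurable N"
  by (simp add: bounded_measurable_def)

lemma bounded_measurable_compose:
  assumes "bounded_measurable N F" "g \<in> N' \<rightarrow>\<^sub>M N"
  shows "bounded_measurable N' (\<lambda>x. F (g x))"
  using assms measurable_space[OF assms(2)]
  by (fastforce simp: bounded_measurable_def intro: measurable_compose)

lemma bounded_measurable_diff: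
  fixes F G :: "'a \<Rightarrow> 'b::{real_normed_vector, second_countable_topology}"
  assumes "bounded_measurable N F" "bounded_measurable N G"
  shows "bounded_measurable N (\<lambda>x. F x - G x)"
proof -
  obtain K L where "\<And>x. x \<in> space N \<Longrightarrow> norm (F x) \<le> K" "\<And>x. x \<in> space N \<Longrightarrow> norm (G x) \<le> L"
    using assms by (auto simp: bounded_measurable_def)
  then show ?thesis using assms
    by (intro bounded_measurableI[where K = "K + L"] borel_measurable_diff)
      (auto intro!: norm_triangle_le_diff add_mono simp: bounded_measurable_def)
qed

lemma bounded_measurable_bounded_linear:
  assumes T: "bounded_linear T" and F: "bounded_measurable N F"
  shows "bounded_measurable N (\<lambda>x. T (F x))"
proof -
  obtain K where K: "\<And>x. x \<in> space N \<Longrightarrow> norm (F x) \<le> K" using F by (auto simp: bounded_measurable_def)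
  obtain L where L: "0 < L" "\<And>x. norm (T x) \<le> norm x * L" using bounded_linear.pos_bounded[OF T] by blast
  have "norm (T (F x)) \<le> K * L" if "x \<in> space N" for x
    using L(2)[of "F x"] mult_right_mono[OF K[OF that], of L] L(1) by linarith
  moreover have "(\<lambda>x. T (F x)) \<in> borel_measurable N"
    by (rule measurable_compose[OF bounded_measurable_borel[OF F]],
        rule borel_measurable_continuous_onI, rule linear_continuous_on, rule T)
  ultimately show ?thesis by (intro bounded_measurableI)
qed

lemma bounded_measurable_matrix_mult:
  fixes F G :: "'a \<Rightarrow> complex^'d^'d"
  assumes "bounded_measurable N F" "bounded_measurable N G"
  shows "bounded_measurable N (\<lambda>x. F x ** G x)"
proof -
  obtain K L where KL: "\<And>x. x \<in> space N \<Longrightarrow> norm (F x) \<le> K" "\<And>x. x \<in> space N \<Longrightarrow> norm (G x) \<le> L"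
    using assms by (auto simp: bounded_measurable_def)
  obtain C where C: "0 < C" "\<And>A B. norm ((A :: complex^'d^'d) ** (B :: complex^'d^'d)) \<le> norm A * norm B * C"
    using mmult.pos_bounded by blast
  have "norm (F x ** G x) \<le> K * L * C" if "x \<in> space N" for x
  proof -
    have "norm (F x) * norm (G x) \<le> K * L"
      using KL[OF that] by (intro mult_mono) (auto intro: order_trans[OF norm_ge_zero])
    then show ?thesis using C(2)[of "F x" "G x"] C(1) by (meson mult_right_mono less_imp_le order_trans)
  qed
  then show ?thesis using assms
    by (intro bounded_measurableI borel_measurable_matrix_mult) (auto simp: bounded_measurable_def)
qed

lemma bounded_measurable_mat_exp:
  fixes F :: "'a \<Rightarrow> complex^'d^'d"
  assumes F: "bounded_measurable N F"
  shows "bounded_measurable N (\<lambda>x. mat_exp (F x))"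
proof -
  obtain L where L: "\<And>x. x \<in> space N \<Longrightarrow> norm (F x) \<le> L" using F by (auto simp: bounded_measurable_def)
  obtain C K :: real where CK: "C \<ge> 0" "K \<ge> 0" "\<And>A :: complex^'d^'d. norm (mat_exp A) \<le> C * exp (K * norm A)"
    by (rule mat_exp_norm_bound[where ?'d = 'd]) blast
  have "norm (mat_exp (F x)) \<le> C * exp (K * L)" if "x \<in> space N" for x
    using CK(3)[of "F x"] mult_left_mono[OF L[OF that] CK(2)] CK(1)
    by (meson exp_le_cancel_iff mult_left_mono order_trans)
  then show ?thesis using bounded_measurable_borel[OF F] by (intro bounded_measurableI) auto
qed

lemma bounded_measurable_integrable:
  fixes F :: "'a \<Rightarrow> 'b::{banach, second_countable_topology}"
  assumes "prob_space N" "bounded_measurable N F"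
  shows "integrable N F"
proof -
  interpret prob_space N by fact
  show ?thesis using assms(2) by (auto simp: bounded_measurable_def intro: integrable_const_bound)
qed

section \<open>Averages over subsets, and a Gronwall inequality\<close>

text \<open>
  Each set with \<open>Suc k\<close> elements arises from \<open>Suc k\<close> pairs of a set with \<open>k\<close> elements and a new point.
\<close>

lemma sum_insert_subsets:
  fixes g :: "'i set \<Rightarrow> real"
  assumes I: "finite I"
  shows "(\<Sum>R | R \<subseteq> I \<and> card R = k. \<Sum>i\<in>I - R. g (insert i R))
    = real (Suc k) * (\<Sum>R | R \<subseteq> I \<and> card R = Suc k. g R)"
proof -
  have fin: "finite {R. R \<subseteq> I \<and> card R = k}" for k using I by simp
  have finR: "finite R" if "R \<subseteq> I" for R using I that by (rule rev_finite_subset)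
  have "(\<Sum>R | R \<subseteq> I \<and> card R = k. \<Sum>i\<in>I - R. g (insert i R))
      = (\<Sum>(R, i)\<in>Sigma {R. R \<subseteq> I \<and> card R = k} (\<lambda>R. I - R). g (insert i R))"
    using I fin by (intro sum.Sigma) auto
  also have "\<dots> = (\<Sum>(R, i)\<in>Sigma {R. R \<subseteq> I \<and> card R = Suc k} (\<lambda>R. R). g R)"
    by (rule sum.reindex_bij_witness[where i = "\<lambda>(R, i). (R - {i}, i)" and j = "\<lambda>(R, i). (insert i R, i)"])
      (auto simp: finR card_insert_if insert_absorb)
  also have "\<dots> = (\<Sum>R | R \<subseteq> I \<and> card R = Suc k. \<Sum>i\<in>R. g R)"
    using fin finR by (intro sum.Sigma[symmetric]) auto
  also have "\<dots> = real (Suc k) * (\<Sum>R | R \<subseteq> I \<and> card R = Suc k. g R)"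
    by (simp add: sum_distrib_left)
  finally show ?thesis .
qed

lemma sum_avoiding_subsets:
  fixes e :: "'i \<Rightarrow> real"
  assumes I: "finite I"
  shows "(\<Sum>R | R \<subseteq> I \<and> card R = k. \<Sum>i\<in>I - R. e i) = real ((card I - 1) choose k) * (\<Sum>i\<in>I. e i)"
proof -
  let ?L = "{R. R \<subseteq> I \<and> card R = k}"
  have fin: "finite ?L" using I by simp
  have "(\<Sum>R\<in>?L. \<Sum>i\<in>I - R. e i) = (\<Sum>R\<in>?L. \<Sum>i\<in>I. if i \<notin> R then e i else 0)"
    using I by (intro sum.cong refl sum.mono_neutral_cong_left) auto
  also have "\<dots> = (\<Sum>i\<in>I. \<Sum>R\<in>?L. if i \<notin> R then e i else 0)" by (rule sum.swap)
  also have "\<dots> = (\<Sum>i\<in>I. real ((card I - 1) choose k) * e i)"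
  proof (intro sum.cong refl)
    fix i assume i: "i \<in> I"
    have "?L \<inter> {R. i \<notin> R} = {R. R \<subseteq> I - {i} \<and> card R = k}" by auto
    then have "card (?L \<inter> {R. i \<notin> R}) = (card I - 1) choose k"
      using n_subsets[of "I - {i}" k] I i by simp
    then show "(\<Sum>R\<in>?L. if i \<notin> R then e i else 0) = real ((card I - 1) choose k) * e i"
      using fin by (simp add: sum.If_cases)
  qed
  finally show ?thesis by (simp add: sum_distrib_left)
qed

text \<open>
  Gronwall's inequality for \<open>\<phi>' \<le> 2 v \<theta> \<phi>\<close>, with the differential inequality replaced by a backward
  Euler step of arbitrary length. Take \<open>N\<close> steps of length \<open>\<theta> / N\<close>: step \<open>k\<close> costs a factor
  \<open>1 / (1 - x)\<close> with \<open>x = 2 v k \<theta>\<^sup>2 / N\<^sup>2\<close>, which is at most \<open>exp (x + 2 x\<^sup>2)\<close>, and the second order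
  terms vanish as \<open>N\<close> tends to infinity.
\<close>

lemma discrete_gronwall_quadratic:
  fixes \<phi> :: "real \<Rightarrow> real"
  assumes nonneg: "\<And>\<theta>. 0 \<le> \<phi> \<theta>" and v: "0 \<le> v"
    and step: "\<And>\<theta> h. 0 \<le> \<theta> \<Longrightarrow> 0 < h \<Longrightarrow> \<phi> (\<theta> + h) \<le> \<phi> \<theta> + h * (2 * v * (\<theta> + h) * \<phi> (\<theta> + h))"
    and \<theta>: "0 \<le> \<theta>"
  shows "\<phi> \<theta> \<le> \<phi> 0 * exp (v * \<theta>\<^sup>2)"
proof (cases "\<theta> = 0")
  case False
  then have \<theta>: "\<theta> > 0" using \<theta> by simp
  let ?bound = "\<lambda>N. \<phi> 0 * exp ((1 + 4 * (v * \<theta>\<^sup>2 / real N)) * (v * \<theta>\<^sup>2 * (1 + 1 / real N)))"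
  have bound: "\<phi> \<theta> \<le> ?bound N" if N: "N > 0" "4 * v * \<theta>\<^sup>2 \<le> real N" for N
  proof -
    define h where "h = \<theta> / real N"
    define e where "e = 1 + 4 * (v * \<theta> * h)"
    have h: "h > 0" using \<theta> N by (simp add: h_def)
    have small: "2 * (v * \<theta> * h) \<le> 1 / 2"
      using N by (simp add: h_def field_simps power2_eq_square)
    have "\<phi> (real k * h) \<le> \<phi> 0 * exp (e * (v * h\<^sup>2 * (real k * (real k + 1))))" if "k \<le> N" for k
      using that
    proof (induction k)
      case (Suc k)
      define x where "x = 2 * v * (real (Suc k) * h) * h"
      have "real (Suc k) * h \<le> \<theta>"
      proof -
        have "real (Suc k) * h \<le> real N * h" using Suc.prems h by (intro mult_right_mono) auto
        then show ?thesis using N by (simp add: h_def)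
      qed
      then have x: "0 \<le> x" "x \<le> 2 * (v * \<theta> * h)"
        using v h by (auto simp: x_def intro!: mult_right_mono mult_left_mono)
      have "x * x \<le> (2 * (v * \<theta> * h)) * x" using x by (intro mult_right_mono) auto
      then have xe: "x + 2 * x\<^sup>2 \<le> e * x" by (simp add: e_def power2_eq_square algebra_simps)
      have "- x - 2 * x\<^sup>2 \<le> ln (1 - x)" using x small by (intro ln_one_minus_pos_lower_bound) auto
      then have "exp (- (e * x)) \<le> exp (ln (1 - x))" using xe by simp
      then have expx: "exp (- (e * x)) \<le> 1 - x" using x small by simp
      have "\<phi> (real (Suc k) * h) * exp (- (e * x)) \<le> \<phi> (real (Suc k) * h) * (1 - x)"
        by (intro mult_left_mono expx nonneg)
      also have "\<dots> \<le> \<phi> (real k * h)"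
        using step[of "real k * h" h] h by (simp add: x_def algebra_simps)
      also have "\<dots> \<le> \<phi> 0 * exp (e * (v * h\<^sup>2 * (real k * (real k + 1))))" using Suc by simp
      finally have "\<phi> (real (Suc k) * h) * exp (- (e * x)) * exp (e * x)
          \<le> \<phi> 0 * exp (e * (v * h\<^sup>2 * (real k * (real k + 1)))) * exp (e * x)"
        by (intro mult_right_mono) auto
      moreover have "e * (v * h\<^sup>2 * (real k * (real k + 1))) + e * x
          = e * (v * h\<^sup>2 * (real (Suc k) * (real (Suc k) + 1)))"
        by (simp add: x_def power2_eq_square algebra_simps)
      ultimately show ?case by (simp add: mult.assoc mult_exp_exp)
    qed simp
    from this[of N] have "\<phi> (real N * h) \<le> \<phi> 0 * exp (e * (v * h\<^sup>2 * (real N * (real N + 1))))" by simp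
    moreover have "real N * h = \<theta>" "h\<^sup>2 * (real N * (real N + 1)) = \<theta>\<^sup>2 * (1 + 1 / real N)"
      "v * \<theta> * h = v * \<theta>\<^sup>2 / real N"
      using N by (simp_all add: h_def field_simps power2_eq_square)
    ultimately show ?thesis by (simp add: e_def mult.assoc)
  qed
  have "?bound \<longlonglongrightarrow> \<phi> 0 * exp ((1 + 4 * 0) * (v * \<theta>\<^sup>2 * (1 + 0)))"
    by (intro tendsto_intros lim_const_over_n)
  moreover have "\<forall>N\<ge>nat \<lceil>4 * v * \<theta>\<^sup>2\<rceil> + 1. \<phi> \<theta> \<le> ?bound N"
  proof (intro allI impI)
    fix N assume "N \<ge> nat \<lceil>4 * v * \<theta>\<^sup>2\<rceil> + 1"
    then show "\<phi> \<theta> \<le> ?bound N" by (intro bound) linarith+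
  qed
  ultimately have "\<phi> \<theta> \<le> \<phi> 0 * exp ((1 + 4 * 0) * (v * \<theta>\<^sup>2 * (1 + 0)))"
    using LIMSEQ_le_const by blast
  then show ?thesis by simp
qed simp

section \<open>The trace moment generating function of a bounded field\<close>

text \<open>
  The bound \<open>v\<close> on the matrix variance is stated through quadratic forms, which is what traces against
  positive matrices need and which involves real integrals only.
\<close>

locale bounded_hermitian_field =
  fixes I :: "'i set" and M :: "'i \<Rightarrow> 'a measure"
    and X :: "('i \<Rightarrow> 'a) \<Rightarrow> complex^'d^'d" and v :: real
  assumes finite_index: "finite I"
    and v_nonneg: "0 \<le> v"
    and prob_factor: "\<And>i. prob_space (M i)"
    and bounded_X: "bounded_measurable (PiM I M) X"
    and hermitian_X: "\<And>z. z \<in> space (PiM I M) \<Longrightarrow> hermitian_mat (X z)"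
    and centered: "integral\<^sup>L (PiM I M) X = 0"
    and variance: "AE z in PiM I M. \<forall>x.
      1 / 2 * (\<Sum>i\<in>I. \<integral>Y. (norm ((X z - X (z(i := Y i))) *v x))\<^sup>2 \<partial>PiM I M) \<le> v * (norm x)\<^sup>2"
begin

abbreviation \<mu> where "\<mu> \<equiv> PiM I M"
abbreviation \<nu> where "\<nu> \<equiv> pairs_measure I M"

definition expX :: "real \<Rightarrow> ('i \<Rightarrow> 'a) \<Rightarrow> complex^'d^'d" where
  "expX \<theta> z = mat_exp (\<theta> *\<^sub>R X z)"

definition mgf :: "real \<Rightarrow> real" where
  "mgf \<theta> = (\<integral>z. re_trace (expX \<theta> z) \<partial>\<mu>)"

text \<open>
  This is the derivative of \<open>mgf\<close>; it is used only through \<open>mgf_step\<close>.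
\<close>

definition mgf_deriv :: "real \<Rightarrow> real" where
  "mgf_deriv \<theta> = (\<integral>z. re_trace (X z ** expX \<theta> z) \<partial>\<mu>)"

lemma prob_mu: "prob_space \<mu>" by (rule prob_space_PiM) (rule prob_factor)
lemma prob_nu: "prob_space \<nu>" by (rule prob_space_pairs_measure) (rule prob_factor)

lemma copy_space: "\<omega> \<in> space \<nu> \<Longrightarrow> copy I R \<omega> \<in> space \<mu>"
  using measurable_space[OF measurable_copy] .

lemma bounded_expX: "bounded_measurable \<mu> (expX \<theta>)"
  unfolding expX_def[abs_def]
  by (rule bounded_measurable_mat_exp)
    (rule bounded_measurable_bounded_linear[OF bounded_linear_scaleR_right bounded_X])

lemma bounded_X_copy: "bounded_measurable \<nu> (\<lambda>\<omega>. X (copy I R \<omega>))"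
  by (rule bounded_measurable_compose[OF bounded_X measurable_copy])

lemma bounded_expX_copy: "bounded_measurable \<nu> (\<lambda>\<omega>. expX \<theta> (copy I R \<omega>))"
  by (rule bounded_measurable_compose[OF bounded_expX measurable_copy])

lemma integrable_re_trace:
  assumes "bounded_measurable \<nu> F"
  shows "integrable \<nu> (\<lambda>\<omega>. re_trace (F \<omega>))"
  by (rule bounded_measurable_integrable[OF prob_nu])
    (rule bounded_measurable_bounded_linear[OF bounded_linear_re_trace assms])

lemma integral_copy:
  fixes g :: "('i \<Rightarrow> 'a) \<Rightarrow> 'b::{banach, second_countable_topology}"
  assumes "g \<in> borel_measurable \<mu>"
  shows "(\<integral>\<omega>. g (copy I R \<omega>) \<partial>\<nu>) = integral\<^sup>L \<mu> g"
  using integral_distr[OF measurable_copy assms, of R] distr_copy[where M = M, OF prob_factor, of I R] by simp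

lemma integral_swap:
  fixes g :: "('i \<times> bool \<Rightarrow> 'a) \<Rightarrow> real"
  assumes "g \<in> borel_measurable \<nu>"
  shows "(\<integral>\<omega>. g (swap I i \<omega>) \<partial>\<nu>) = integral\<^sup>L \<nu> g"
  using integral_distr[OF measurable_swap assms, of i] distr_swap[where M = M, OF prob_factor, of I i] by simp

lemma integral_nu_mix:
  fixes g :: "('i \<times> bool \<Rightarrow> 'a) \<Rightarrow> real"
  assumes "integrable \<nu> g"
  shows "integral\<^sup>L \<nu> g = (\<integral>\<omega>. (\<integral>\<omega>'. g (mix (I \<times> UNIV) S \<omega> \<omega>') \<partial>\<nu>) \<partial>\<nu>)"
    and "integrable \<nu> (\<lambda>\<omega>. \<integral>\<omega>'. g (mix (I \<times> UNIV) S \<omega> \<omega>') \<partial>\<nu>)"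
  using integral_mix[of "I \<times> UNIV" "\<lambda>j. M (fst j)" g S] assms finite_index prob_factor
  by (simp_all add: pairs_measure_def)

text \<open>
  The quantity \<open>interp\<close> leads from \<open>mgf_deriv\<close> at \<open>R = {}\<close> to \<open>0\<close> at \<open>R = I\<close>. The costs \<open>energy\<close> of
  adding the point \<open>i\<close> to \<open>R\<close> are what the mean value trace inequality produces.
\<close>

definition interp :: "real \<Rightarrow> 'i set \<Rightarrow> real" where
  "interp \<theta> R = (\<integral>\<omega>. re_trace (X (copy I R \<omega>) ** expX \<theta> (copy I {} \<omega>)) \<partial>\<nu>)"

definition energy :: "real \<Rightarrow> 'i set \<Rightarrow> 'i \<Rightarrow> real" where
  "energy \<theta> R i = (\<integral>\<omega>. re_trace ((X (copy I R \<omega>) - X (copy I (insert i R) \<omega>)) **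
     (X (copy I R \<omega>) - X (copy I (insert i R) \<omega>)) ** expX \<theta> (copy I {} \<omega>)) \<partial>\<nu>)"

lemma interp_empty: "interp \<theta> {} = mgf_deriv \<theta>"
proof -
  have "(\<lambda>z. re_trace (X z ** expX \<theta> z)) \<in> borel_measurable \<mu>"
    by (rule bounded_measurable_borel)
      (intro bounded_measurable_bounded_linear[OF bounded_linear_re_trace]
        bounded_measurable_matrix_mult bounded_X bounded_expX)
  from integral_copy[OF this, of "{}"] show ?thesis
    by (simp add: interp_def mgf_deriv_def)
qed

text \<open>
  For \<open>R = I\<close> the two factors depend on independent copies, and \<open>X\<close> has mean zero.
\<close>

lemma interp_full: "interp \<theta> I = 0"
proof -
  let ?S = "I \<times> {True}"
  have mix: "copy I I (mix (I \<times> UNIV) ?S \<omega> \<omega>') = copy I I \<omega>'"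
    "copy I {} (mix (I \<times> UNIV) ?S \<omega> \<omega>') = copy I {} \<omega>" for \<omega> \<omega>' :: "'i \<times> bool \<Rightarrow> 'a"
    by (auto simp: copy_def mix_def fun_eq_iff)
  have bl: "bounded_linear (\<lambda>A. re_trace (A ** B))" for B :: "complex^'d^'d"
    by (rule bounded_linear_compose[OF bounded_linear_re_trace mmult.bounded_linear_left])
  have "interp \<theta> I = (\<integral>\<omega>. (\<integral>\<omega>'. re_trace (X (copy I I \<omega>') ** expX \<theta> (copy I {} \<omega>)) \<partial>\<nu>) \<partial>\<nu>)"
    unfolding interp_def
    by (subst integral_nu_mix(1)[where S = ?S])
      (auto simp: mix intro!: integrable_re_trace bounded_measurable_matrix_mult
        bounded_X_copy bounded_expX_copy)
  also have "\<dots> = (\<integral>\<omega>. re_trace (integral\<^sup>L \<mu> X ** expX \<theta> (copy I {} \<omega>)) \<partial>\<nu>)"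
    using bounded_measurable_integrable[OF prob_nu bounded_X_copy]
      integral_copy[OF bounded_measurable_borel[OF bounded_X]]
    by (simp add: integral_bounded_linear[OF bl])
  also have "\<dots> = 0" by (simp add: centered mmult.zero_left trace_def)
  finally show ?thesis .
qed

text \<open>
  Exchanging the two copies of coordinate \<open>i\<close> preserves the measure, changes the signs of \<open>C\<close> and \<open>D\<close>,
  and interchanges \<open>E\<close> and \<open>E'\<close>. Hence the increment is half of the integral of \<open>tr(C (E - E'))\<close>, to which
  the mean value trace inequality applies; the same exchange identifies the resulting integrals with \<open>E\<close>
  and with \<open>E'\<close>.
\<close>

lemma interp_diff_le:
  assumes i: "i \<in> I" "i \<notin> R" and \<theta>: "\<theta> > 0" and s: "s > 0"
  shows "interp \<theta> R - interp \<theta> (insert i R) \<le> 1 / 4 * (s * \<theta>\<^sup>2 * energy \<theta> {} i + energy \<theta> R i / s)"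
proof -
  define C where "C = (\<lambda>\<omega>. X (copy I R \<omega>) - X (copy I (insert i R) \<omega>))"
  define D where "D = (\<lambda>\<omega>. X (copy I {} \<omega>) - X (copy I {i} \<omega>))"
  define E where "E = (\<lambda>\<omega>. expX \<theta> (copy I {} \<omega>))"
  define E' where "E' = (\<lambda>\<omega>. expX \<theta> (copy I {i} \<omega>))"
  define P where "P = (\<lambda>\<omega>. (s * \<theta>\<^sup>2) *\<^sub>R (D \<omega> ** D \<omega>) + (1 / s) *\<^sub>R (C \<omega> ** C \<omega>))"
  note bm_intros = bounded_measurable_diff bounded_measurable_matrix_mult bounded_X_copy bounded_expX_copy
  have bm: "bounded_measurable \<nu> C" "bounded_measurable \<nu> D" "bounded_measurable \<nu> E" "bounded_measurable \<nu> E'"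
    unfolding C_def D_def E_def E'_def by (intro bm_intros)+
  have int_tr: "integrable \<nu> (\<lambda>\<omega>. re_trace (A \<omega> ** B \<omega>))"
    if "bounded_measurable \<nu> A" "bounded_measurable \<nu> B"
    for A B :: "('i \<times> bool \<Rightarrow> 'a) \<Rightarrow> complex^'d^'d"
    by (intro integrable_re_trace bounded_measurable_matrix_mult that)
  have bmP: "bounded_measurable \<nu> P"
  proof -
    have "bounded_measurable \<nu> (\<lambda>\<omega>. (s * \<theta>\<^sup>2) *\<^sub>R (D \<omega> ** D \<omega>) - (- 1 / s) *\<^sub>R (C \<omega> ** C \<omega>))"
      by (intro bounded_measurable_diff bounded_measurable_bounded_linear[OF bounded_linear_scaleR_right]
          bounded_measurable_matrix_mult bm)
    then show ?thesis by (simp add: P_def)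
  qed
  have swap: "C (swap I i \<omega>) = - C \<omega>" "D (swap I i \<omega>) = - D \<omega>" "E (swap I i \<omega>) = E' \<omega>" for \<omega>
    using i by (simp_all add: C_def D_def E_def E'_def copy_swap)
  have swapP: "P (swap I i \<omega>) = P \<omega>" for \<omega>
    by (simp add: P_def swap mmult.minus_left mmult.minus_right)
  have diff: "interp \<theta> R - interp \<theta> (insert i R) = (\<integral>\<omega>. re_trace (C \<omega> ** E \<omega>) \<partial>\<nu>)"
    unfolding interp_def C_def E_def
    by (simp add: mmult.diff_left trace_sub Bochner_Integration.integral_diff int_tr
        bounded_X_copy bounded_expX_copy)
  have flip: "(\<integral>\<omega>. re_trace (C \<omega> ** E \<omega>) \<partial>\<nu>) = - (\<integral>\<omega>. re_trace (C \<omega> ** E' \<omega>) \<partial>\<nu>)"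
  proof -
    have "(\<integral>\<omega>. re_trace (C \<omega> ** E \<omega>) \<partial>\<nu>) = (\<integral>\<omega>. re_trace (C (swap I i \<omega>) ** E (swap I i \<omega>)) \<partial>\<nu>)"
      by (rule integral_swap[symmetric]) (use int_tr[OF bm(1,3)] in simp)
    also have "\<dots> = - (\<integral>\<omega>. re_trace (C \<omega> ** E' \<omega>) \<partial>\<nu>)"
      by (simp add: swap mmult.minus_left trace_def sum_negf)
    finally show ?thesis .
  qed
  have "2 * (interp \<theta> R - interp \<theta> (insert i R)) = (\<integral>\<omega>. re_trace (C \<omega> ** (E \<omega> - E' \<omega>)) \<partial>\<nu>)"
    using diff flip by (simp add: mmult.diff_right trace_sub Bochner_Integration.integral_diff int_tr bm)
  also have "\<dots> \<le> (\<integral>\<omega>. 1 / 4 * (re_trace (P \<omega> ** E \<omega>) + re_trace (P \<omega> ** E' \<omega>)) \<partial>\<nu>)"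
  proof (rule integral_mono)
    show "integrable \<nu> (\<lambda>\<omega>. re_trace (C \<omega> ** (E \<omega> - E' \<omega>)))"
      by (intro int_tr bounded_measurable_diff bm)
    show "integrable \<nu> (\<lambda>\<omega>. 1 / 4 * (re_trace (P \<omega> ** E \<omega>) + re_trace (P \<omega> ** E' \<omega>)))"
      using int_tr[OF bmP bm(3)] int_tr[OF bmP bm(4)] by simp
    fix \<omega> assume \<omega>: "\<omega> \<in> space \<nu>"
    have herm: "hermitian_mat (X (copy I S \<omega>))" for S
      by (rule hermitian_X[OF copy_space[OF \<omega>]])
    have "re_trace (C \<omega> ** (E \<omega> - E' \<omega>))
      \<le> 1 / 4 * re_trace ((s *\<^sub>R ((\<theta> *\<^sub>R X (copy I {} \<omega>) - \<theta> *\<^sub>R X (copy I {i} \<omega>)) **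
          (\<theta> *\<^sub>R X (copy I {} \<omega>) - \<theta> *\<^sub>R X (copy I {i} \<omega>))) + (1 / s) *\<^sub>R (C \<omega> ** C \<omega>)) ** (E \<omega> + E' \<omega>))"
      unfolding E_def E'_def expX_def
      by (intro re_trace_exp_difference hermitian_mat_scaleR herm s)
        (simp add: C_def hermitian_mat_diff herm)
    also have "s *\<^sub>R ((\<theta> *\<^sub>R X (copy I {} \<omega>) - \<theta> *\<^sub>R X (copy I {i} \<omega>)) **
          (\<theta> *\<^sub>R X (copy I {} \<omega>) - \<theta> *\<^sub>R X (copy I {i} \<omega>))) + (1 / s) *\<^sub>R (C \<omega> ** C \<omega>) = P \<omega>"
      unfolding P_def D_def scaleR_diff_right[symmetric] mmult.scaleR_left mmult.scaleR_right
      by (simp add: power2_eq_square mult.assoc)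
    finally show "re_trace (C \<omega> ** (E \<omega> - E' \<omega>)) \<le> 1 / 4 * (re_trace (P \<omega> ** E \<omega>) + re_trace (P \<omega> ** E' \<omega>))"
      by (simp add: mmult.add_right trace_add)
  qed
  also have "\<dots> = 1 / 4 * ((\<integral>\<omega>. re_trace (P \<omega> ** E \<omega>) \<partial>\<nu>) + (\<integral>\<omega>. re_trace (P \<omega> ** E' \<omega>) \<partial>\<nu>))"
    by (simp add: int_tr bmP bm)
  also have "(\<integral>\<omega>. re_trace (P \<omega> ** E' \<omega>) \<partial>\<nu>) = (\<integral>\<omega>. re_trace (P \<omega> ** E \<omega>) \<partial>\<nu>)"
    using integral_swap[of "\<lambda>\<omega>. re_trace (P \<omega> ** E \<omega>)" i] int_tr[OF bmP bm(3)]
    by (simp add: swapP swap)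
  also have "(\<integral>\<omega>. re_trace (P \<omega> ** E \<omega>) \<partial>\<nu>) = s * \<theta>\<^sup>2 * energy \<theta> {} i + energy \<theta> R i / s"
  proof -
    have "re_trace (P \<omega> ** E \<omega>)
        = s * \<theta>\<^sup>2 * re_trace (D \<omega> ** D \<omega> ** E \<omega>) + re_trace (C \<omega> ** C \<omega> ** E \<omega>) / s" for \<omega>
      by (simp add: P_def mmult.add_left mmult.scaleR_left trace_add re_trace_scaleR)
    moreover have "integrable \<nu> (\<lambda>\<omega>. re_trace (D \<omega> ** D \<omega> ** E \<omega>))"
      "integrable \<nu> (\<lambda>\<omega>. re_trace (C \<omega> ** C \<omega> ** E \<omega>))"
      by (intro int_tr bounded_measurable_matrix_mult bm)+
    ultimately show ?thesis
      by (simp add: energy_def C_def D_def E_def)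
  qed
  finally show ?thesis by simp
qed

lemma bounded_X_update:
  assumes "w \<in> space \<mu>" "i \<in> I"
  shows "bounded_measurable \<mu> (\<lambda>Y. X w - X (w(i := Y i)))"
proof -
  have "w \<in> extensional I" using assms(1) by (simp add: space_PiM PiE_iff)
  then have "(\<lambda>Y. w(i := Y i)) = mix I {i} w"
    by (intro ext) (simp only: mix_singleton[OF assms(2)])
  then have "(\<lambda>Y. w(i := Y i)) \<in> \<mu> \<rightarrow>\<^sub>M \<mu>" using measurable_mix1[OF assms(1)] by simp
  from bounded_measurable_compose[OF bounded_X this]
  show ?thesis by (intro bounded_measurable_diff) (auto intro!: bounded_measurableI)
qed

lemma update_space:
  assumes "w \<in> space \<mu>" "Y \<in> space \<mu>" "i \<in> I"
  shows "w(i := Y i) \<in> space \<mu>"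
  using mix_in_space[OF assms(1,2), of "{i}"] mix_singleton[OF assms(3), of w Y] assms(1)
  by (simp add: space_PiM PiE_iff)

text \<open>
  In an eigenbasis of \<open>X z\<close> the trace is a positive combination of the quadratic forms of the matrix
  variance at \<open>w\<close>. Restricting the sum to \<open>K\<close> only drops nonnegative terms.
\<close>

lemma conditional_energy_le:
  assumes w: "w \<in> space \<mu>" and z: "z \<in> space \<mu>" and K: "K \<subseteq> I"
    and var: "\<And>x. 1 / 2 * (\<Sum>i\<in>I. \<integral>Y. (norm ((X w - X (w(i := Y i))) *v x))\<^sup>2 \<partial>\<mu>) \<le> v * (norm x)\<^sup>2"
  shows "(\<Sum>i\<in>K. \<integral>Y. re_trace ((X w - X (w(i := Y i))) ** (X w - X (w(i := Y i))) ** expX \<theta> z) \<partial>\<mu>)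
    \<le> 2 * v * re_trace (expX \<theta> z)"
proof -
  obtain B where B: "eigenbasis (X z) B" using hermitian_eigenbasis[OF hermitian_X[OF z]] .
  define e where "e = (\<lambda>b. exp (\<theta> * (b \<bullet> (X z *v b))))"
  define D where "D = (\<lambda>i Y. X w - X (w(i := Y i)))"
  have norm1: "norm b = 1" if "b \<in> B" for b
    using eigenbasis_orthonormal[OF B] that by (simp add: orthonormal_basis_def)
  have each: "2 * (\<integral>Y. re_trace (D i Y ** D i Y ** expX \<theta> z) \<partial>\<mu>)
      = (\<Sum>b\<in>B. e b * (\<integral>Y. (norm (D i Y *v b))\<^sup>2 \<partial>\<mu>))" if i: "i \<in> I" for i
  proof -
    have bmD: "bounded_measurable \<mu> (\<lambda>Y. D i Y ** D i Y)"
      unfolding D_def by (intro bounded_measurable_matrix_mult bounded_X_update w i)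
    have bl: "bounded_linear (\<lambda>A :: complex^'d^'d. b \<bullet> (A *v b))" for b
      by (rule bounded_linear_compose[OF bounded_linear_inner_right bounded_linear_apply_vector])
    have int: "integrable \<mu> (\<lambda>Y. b \<bullet> ((D i Y ** D i Y) *v b))" for b
      by (rule bounded_measurable_integrable[OF prob_mu])
        (rule bounded_measurable_bounded_linear[OF bl bmD])
    have "2 * (\<integral>Y. re_trace (D i Y ** D i Y ** expX \<theta> z) \<partial>\<mu>)
        = (\<integral>Y. (\<Sum>b\<in>B. e b * (b \<bullet> ((D i Y ** D i Y) *v b))) \<partial>\<mu>)"
      unfolding integral_mult_right_zero[symmetric] expX_def re_trace_mult_mat_exp[OF B] e_def ..
    also have "\<dots> = (\<Sum>b\<in>B. e b * (\<integral>Y. b \<bullet> ((D i Y ** D i Y) *v b) \<partial>\<mu>))"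
      by (simp add: int)
    also have "\<dots> = (\<Sum>b\<in>B. e b * (\<integral>Y. (norm (D i Y *v b))\<^sup>2 \<partial>\<mu>))"
    proof (intro sum.cong arg_cong2[where f = "(*)"] refl Bochner_Integration.integral_cong)
      fix b Y assume "Y \<in> space \<mu>"
      then have "hermitian_mat (D i Y)"
        unfolding D_def by (intro hermitian_mat_diff hermitian_X w update_space i)
      then show "b \<bullet> ((D i Y ** D i Y) *v b) = (norm (D i Y *v b))\<^sup>2"
        by (rule hermitian_mat_square_inner)
    qed
    finally show ?thesis .
  qed
  have "2 * (\<Sum>i\<in>K. \<integral>Y. re_trace (D i Y ** D i Y ** expX \<theta> z) \<partial>\<mu>)
      = (\<Sum>i\<in>K. \<Sum>b\<in>B. e b * (\<integral>Y. (norm (D i Y *v b))\<^sup>2 \<partial>\<mu>))"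
    unfolding sum_distrib_left using K by (intro sum.cong refl each) auto
  also have "\<dots> \<le> (\<Sum>i\<in>I. \<Sum>b\<in>B. e b * (\<integral>Y. (norm (D i Y *v b))\<^sup>2 \<partial>\<mu>))"
    using K finite_index by (intro sum_mono2) (auto intro!: sum_nonneg simp: e_def)
  also have "\<dots> = (\<Sum>b\<in>B. e b * (\<Sum>i\<in>I. \<integral>Y. (norm (D i Y *v b))\<^sup>2 \<partial>\<mu>))"
    by (subst sum.swap) (simp add: sum_distrib_left)
  also have "\<dots> \<le> (\<Sum>b\<in>B. e b * (2 * v))"
  proof (intro sum_mono mult_left_mono)
    fix b assume "b \<in> B"
    then show "(\<Sum>i\<in>I. \<integral>Y. (norm (D i Y *v b))\<^sup>2 \<partial>\<mu>) \<le> 2 * v"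
      using var[of b] norm1[of b] by (simp add: D_def)
  qed (simp add: e_def)
  also have "\<dots> = 2 * (2 * v * re_trace (expX \<theta> z))"
    using re_trace_mat_exp[OF B, of \<theta>] by (simp add: expX_def e_def sum_distrib_right[symmetric])
  finally show ?thesis by (simp add: D_def)
qed

text \<open>
  For \<open>i \<notin> R\<close> neither \<open>Z\<close> nor \<open>Z\<^sup>R\<close> involves the second copy of coordinate \<open>i\<close>. That coordinate may
  therefore be drawn afresh, so that \<open>C\<^sup>2\<close> averages to the \<open>i\<close>-th part of the matrix variance at \<open>Z\<^sup>R\<close>.
\<close>

lemma energy_sum_le:
  assumes R: "R \<subseteq> I"
  shows "(\<Sum>i\<in>I - R. energy \<theta> R i) \<le> 2 * v * mgf \<theta>"
proof -
  define q where "q = (\<lambda>i \<omega>. \<integral>Y. re_trace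
    ((X (copy I R \<omega>) - X ((copy I R \<omega>)(i := Y i))) **
     (X (copy I R \<omega>) - X ((copy I R \<omega>)(i := Y i))) ** expX \<theta> (copy I {} \<omega>)) \<partial>\<mu>)"
  have energy: "energy \<theta> R i = integral\<^sup>L \<nu> (q i)" "integrable \<nu> (q i)" if i: "i \<in> I - R" for i
  proof -
    let ?g = "\<lambda>\<omega>. re_trace ((X (copy I R \<omega>) - X (copy I (insert i R) \<omega>)) **
       (X (copy I R \<omega>) - X (copy I (insert i R) \<omega>)) ** expX \<theta> (copy I {} \<omega>))"
    let ?S = "{(i, True)}"
    have int: "integrable \<nu> ?g"
      by (intro integrable_re_trace bounded_measurable_matrix_mult bounded_measurable_diff
          bounded_X_copy bounded_expX_copy)
    have mix: "copy I R (mix (I \<times> UNIV) ?S \<omega> \<omega>') = copy I R \<omega>"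
      "copy I {} (mix (I \<times> UNIV) ?S \<omega> \<omega>') = copy I {} \<omega>"
      "copy I (insert i R) (mix (I \<times> UNIV) ?S \<omega> \<omega>') = (copy I R \<omega>)(i := copy I I \<omega>' i)"
      for \<omega> \<omega>' :: "'i \<times> bool \<Rightarrow> 'a"
      using i by (auto simp: copy_def mix_def fun_eq_iff)
    have q: "(\<integral>\<omega>'. ?g (mix (I \<times> UNIV) ?S \<omega> \<omega>') \<partial>\<nu>) = q i \<omega>" if \<omega>: "\<omega> \<in> space \<nu>" for \<omega>
      unfolding mix q_def
    proof (rule integral_copy)
      have c: "bounded_measurable \<mu> (\<lambda>Y. expX \<theta> (copy I {} \<omega>))"
        by (rule bounded_measurableI) auto
      show "(\<lambda>Y. re_trace ((X (copy I R \<omega>) - X ((copy I R \<omega>)(i := Y i))) **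
          (X (copy I R \<omega>) - X ((copy I R \<omega>)(i := Y i))) ** expX \<theta> (copy I {} \<omega>))) \<in> borel_measurable \<mu>"
        using i by (intro bounded_measurable_borel
            bounded_measurable_bounded_linear[OF bounded_linear_re_trace]
            bounded_measurable_matrix_mult bounded_X_update copy_space \<omega> c) auto
    qed
    show "integrable \<nu> (q i)"
      using integral_nu_mix(2)[OF int, of ?S] by (rule Bochner_Integration.integrable_cong[THEN iffD1, rotated -1]) (simp_all only: q)
    show "energy \<theta> R i = integral\<^sup>L \<nu> (q i)"
      unfolding energy_def integral_nu_mix(1)[OF int, of ?S]
      by (rule Bochner_Integration.integral_cong) (simp_all only: q)
  qed
  have int_exp: "integrable \<nu> (\<lambda>\<omega>. re_trace (expX \<theta> (copy I {} \<omega>)))"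
    by (rule integrable_re_trace[OF bounded_expX_copy])
  have "(\<Sum>i\<in>I - R. energy \<theta> R i) = (\<integral>\<omega>. (\<Sum>i\<in>I - R. q i \<omega>) \<partial>\<nu>)"
    by (simp add: energy)
  also have "\<dots> \<le> (\<integral>\<omega>. 2 * v * re_trace (expX \<theta> (copy I {} \<omega>)) \<partial>\<nu>)"
  proof (rule integral_mono_AE)
    show "integrable \<nu> (\<lambda>\<omega>. \<Sum>i\<in>I - R. q i \<omega>)"
      by (rule Bochner_Integration.integrable_sum) (rule energy(2))
    show "integrable \<nu> (\<lambda>\<omega>. 2 * v * re_trace (expX \<theta> (copy I {} \<omega>)))" using int_exp by simp
    have "AE \<omega> in \<nu>. \<forall>x. 1 / 2 * (\<Sum>i\<in>I. \<integral>Y. (norm ((X (copy I R \<omega>) - X ((copy I R \<omega>)(i := Y i))) *v x))\<^sup>2 \<partial>\<mu>)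
        \<le> v * (norm x)\<^sup>2"
      using variance by (intro AE_distrD[OF measurable_copy]) (simp only: distr_copy[OF prob_factor])
    then show "AE \<omega> in \<nu>. (\<Sum>i\<in>I - R. q i \<omega>) \<le> 2 * v * re_trace (expX \<theta> (copy I {} \<omega>))"
      by (rule AE_mp) (intro AE_I2 impI, unfold q_def,
        intro conditional_energy_le copy_space, auto)
  qed
  also have "\<dots> = 2 * v * mgf \<theta>"
  proof -
    have "(\<lambda>z. re_trace (expX \<theta> z)) \<in> borel_measurable \<mu>"
      by (intro bounded_measurable_borel bounded_measurable_bounded_linear[OF bounded_linear_re_trace]
          bounded_expX)
    then show ?thesis using integral_copy[of "\<lambda>z. re_trace (expX \<theta> z)" "{}"] by (simp add: mgf_def)
  qed
  finally show ?thesis .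
qed

lemma mgf_nonneg: "0 \<le> mgf \<theta>"
  unfolding mgf_def expX_def
  by (rule integral_nonneg_AE, rule AE_I2)
    (intro re_trace_mat_exp_nonneg hermitian_mat_scaleR hermitian_X)

text \<open>
  Let \<open>a k\<close> be the average of \<open>interp\<close> over the sets with \<open>k\<close> elements. Counting pairs \<open>(R, i)\<close> with
  \<open>i \<notin> R\<close> in two ways expresses \<open>a k - a (Suc k)\<close> as an average of one-point increments; there are
  \<open>w\<close> such pairs. The bounds for the single levels telescope, because
  \<open>1 / (2 sqrt j) \<le> sqrt j - sqrt (j - 1)\<close>.
\<close>

lemma mgf_deriv_le:
  assumes \<theta>: "\<theta> > 0"
  shows "mgf_deriv \<theta> \<le> 2 * v * \<theta> * mgf \<theta>"
proof -
  define n where "n = card I"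
  define L where "L = (\<lambda>k. {R. R \<subseteq> I \<and> card R = k})"
  define b where "b = (\<lambda>k. \<Sum>R\<in>L k. interp \<theta> R)"
  define a where "a = (\<lambda>k. b k / real (n choose k))"
  define c where "c = 2 * v * \<theta> * mgf \<theta> / sqrt (real n)"
  have card_L: "card (L k) = n choose k" for k
    unfolding L_def n_def by (rule n_subsets[OF finite_index])
  have step: "a k - a (Suc k) \<le> c * (sqrt (real (n - k)) - sqrt (real (n - Suc k)))" if k: "k < n" for k
  proof -
    \<comment> \<open>This \<open>s\<close> makes the contributions of \<open>D\<^sup>2\<close> and \<open>C\<^sup>2\<close> equal.\<close>
    define s where "s = sqrt (real n / real (n - k)) / \<theta>"
    define w where "w = real n * real ((n - 1) choose k)"
    have s: "s > 0" using k \<theta> by (simp add: s_def)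
    have w1: "real (n - k) * real (n choose k) = w"
      using binomial_absorb_comp[of n k] k unfolding w_def by (metis of_nat_mult)
    have w2: "real (Suc k) * real (n choose Suc k) = w"
      using binomial_absorption[of k n] unfolding w_def by (metis of_nat_mult)
    have w_pos: "w > 0" using k by (simp add: w_def zero_less_binomial)
    have "w * (a k - a (Suc k)) = real (n - k) * b k - real (Suc k) * b (Suc k)"
    proof -
      have "w * a k = real (n - k) * b k"
        using k w1[symmetric] by (simp add: a_def zero_less_binomial)
      moreover have "w * a (Suc k) = real (Suc k) * b (Suc k)"
        using k w2[symmetric] by (simp add: a_def zero_less_binomial)
      ultimately show ?thesis by (simp add: right_diff_distrib)
    qed
    also have "\<dots> = (\<Sum>R\<in>L k. \<Sum>i\<in>I - R. interp \<theta> R - interp \<theta> (insert i R))"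
    proof -
      have "card (I - R) = n - k" if "R \<in> L k" for R
        using that finite_index by (auto simp: L_def n_def card_Diff_subset finite_subset)
      moreover have "(\<Sum>R\<in>L k. \<Sum>i\<in>I - R. interp \<theta> (insert i R)) = real (Suc k) * b (Suc k)"
        unfolding b_def L_def by (rule sum_insert_subsets[OF finite_index])
      ultimately show ?thesis
        by (simp add: sum_subtractf fun_cong[OF b_def, of k] sum_distrib_left)
    qed
    also have "\<dots> \<le> (\<Sum>R\<in>L k. \<Sum>i\<in>I - R. 1 / 4 * (s * \<theta>\<^sup>2 * energy \<theta> {} i + energy \<theta> R i / s))"
      by (intro sum_mono interp_diff_le \<theta> s) auto
    also have "\<dots> = 1 / 4 * (s * \<theta>\<^sup>2 * (\<Sum>R\<in>L k. \<Sum>i\<in>I - R. energy \<theta> {} i)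
        + (\<Sum>R\<in>L k. \<Sum>i\<in>I - R. energy \<theta> R i) / s)"
      by (simp only: sum_distrib_left sum_divide_distrib flip: sum.distrib)
    also have "(\<Sum>R\<in>L k. \<Sum>i\<in>I - R. energy \<theta> {} i) = real ((n - 1) choose k) * (\<Sum>i\<in>I. energy \<theta> {} i)"
      unfolding L_def n_def by (rule sum_avoiding_subsets[OF finite_index])
    also have "1 / 4 * (s * \<theta>\<^sup>2 * (real ((n - 1) choose k) * (\<Sum>i\<in>I. energy \<theta> {} i))
          + (\<Sum>R\<in>L k. \<Sum>i\<in>I - R. energy \<theta> R i) / s)
        \<le> 1 / 4 * (s * \<theta>\<^sup>2 * (real ((n - 1) choose k) * (2 * v * mgf \<theta>))
          + (\<Sum>R\<in>L k. 2 * v * mgf \<theta>) / s)"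
      using energy_sum_le[of "{}" \<theta>] s
      by (intro mult_left_mono add_mono divide_right_mono sum_mono energy_sum_le) (auto simp: L_def)
    also have "\<dots> = w * (v * mgf \<theta> / 2 * (s * \<theta>\<^sup>2 / real n + 1 / (s * real (n - k))))"
    proof -
      have c1: "real (n choose k) = w / real (n - k)" using w1[symmetric] k by simp
      have c2: "real ((n - 1) choose k) = w / real n" using k by (simp add: w_def)
      have "1 / 4 * (s * t * (w / p * (2 * v * m)) + w / q * (2 * v * m) / s)
          = w * (v * m / 2 * (s * t / p + 1 / (s * q)))" if "p \<noteq> 0" "q \<noteq> 0" for p q t m :: real
        using s that by (simp add: field_simps)
      then show ?thesis unfolding sum_constant card_L c1 c2 using k by simp
    qed
    finally have "a k - a (Suc k) \<le> v * mgf \<theta> / 2 * (s * \<theta>\<^sup>2 / real n + 1 / (s * real (n - k)))"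
      using w_pos by (simp add: mult_le_cancel_left)
    also have "s * \<theta>\<^sup>2 / real n + 1 / (s * real (n - k)) = 2 * \<theta> / (sqrt (real n) * sqrt (real (n - k)))"
    proof -
      define p q where "p = sqrt (real n)" and "q = sqrt (real (n - k))"
      have pq: "p > 0" "q > 0" "real n = p * p" "real (n - k) = q * q"
        using k by (simp_all add: p_def q_def)
      have s_eq: "s = p / q / \<theta>" by (simp add: s_def p_def q_def real_sqrt_divide)
      show ?thesis unfolding p_def[symmetric] q_def[symmetric] pq(3,4) s_eq using pq(1,2) \<theta>
        by (simp add: field_simps power2_eq_square)
    qed
    also have "v * mgf \<theta> / 2 * (2 * \<theta> / (sqrt (real n) * sqrt (real (n - k))))
        = c * (1 / (2 * sqrt (real (n - k))))"
      by (simp add: c_def)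
    also have "\<dots> \<le> c * (sqrt (real (n - k)) - sqrt (real (n - Suc k)))"
    proof (intro mult_left_mono)
      define p q where "p = sqrt (real (n - k))" and "q = sqrt (real (n - Suc k))"
      have "p\<^sup>2 - q\<^sup>2 = 1" using k by (simp add: p_def q_def of_nat_diff)
      moreover have "p > 0" "q \<ge> 0" "q \<le> p" using k by (simp_all add: p_def q_def)
      ultimately have "1 \<le> (p - q) * (2 * p)"
        using mult_left_mono[of "p + q" "2 * p" "p - q"] by (simp add: power2_eq_square algebra_simps)
      then show "1 / (2 * p) \<le> p - q" using \<open>p > 0\<close> by (simp add: divide_le_eq)
    qed (use v_nonneg mgf_nonneg \<theta> in \<open>simp add: c_def\<close>)
    finally show ?thesis .
  qed
  have "a 0 - a n = (\<Sum>k<n. a k - a (Suc k))" by (rule sum_lessThan_telescope'[symmetric])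
  also have "\<dots> \<le> (\<Sum>k<n. c * (sqrt (real (n - k)) - sqrt (real (n - Suc k))))"
    by (intro sum_mono step) simp
  also have "\<dots> = c * sqrt (real n)"
    using sum_lessThan_telescope'[of "\<lambda>k. sqrt (real (n - k))" n] by (simp flip: sum_distrib_left)
  also have "\<dots> \<le> 2 * v * \<theta> * mgf \<theta>"
    using v_nonneg mgf_nonneg \<theta> by (simp add: c_def)
  finally have "a 0 - a n \<le> 2 * v * \<theta> * mgf \<theta>" .
  moreover have "a 0 = mgf_deriv \<theta>"
  proof -
    have "L 0 = {{}}" using finite_index by (auto simp: L_def finite_subset)
    then show ?thesis by (simp add: a_def b_def interp_empty)
  qed
  moreover have "a n = 0"
  proof -
    have "L n = {I}" using card_subset_eq[OF finite_index] by (auto simp: L_def n_def)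
    then show ?thesis by (simp add: a_def b_def interp_full)
  qed
  ultimately show ?thesis by simp
qed

lemma mgf_step: "mgf (\<theta> + h) \<le> mgf \<theta> + h * mgf_deriv (\<theta> + h)"
proof -
  have int: "integrable \<mu> (\<lambda>z. re_trace (expX \<theta> z))" for \<theta>
    by (intro bounded_measurable_integrable[OF prob_mu]
        bounded_measurable_bounded_linear[OF bounded_linear_re_trace] bounded_expX)
  have int': "integrable \<mu> (\<lambda>z. re_trace (X z ** expX \<theta> z))" for \<theta>
    by (intro bounded_measurable_integrable[OF prob_mu] bounded_measurable_matrix_mult
        bounded_measurable_bounded_linear[OF bounded_linear_re_trace] bounded_expX bounded_X)
  have "mgf (\<theta> + h) \<le> (\<integral>z. re_trace (expX \<theta> z) + h * re_trace (X z ** expX (\<theta> + h) z) \<partial>\<mu>)"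
    unfolding mgf_def using int int'
    by (intro integral_mono) (auto simp: expX_def intro: re_trace_mat_exp_step hermitian_X)
  also have "\<dots> = mgf \<theta> + h * mgf_deriv (\<theta> + h)"
    by (simp add: mgf_def mgf_deriv_def int int')
  finally show ?thesis .
qed

theorem mgf_le:
  assumes "0 \<le> \<theta>"
  shows "mgf \<theta> \<le> real CARD('d) * exp (v * \<theta>\<^sup>2)"
proof -
  interpret prob_space \<mu> by (rule prob_mu)
  have "mgf \<theta> \<le> mgf 0 * exp (v * \<theta>\<^sup>2)"
  proof (rule discrete_gronwall_quadratic[OF mgf_nonneg v_nonneg _ assms])
    fix \<theta> h :: real assume "0 \<le> \<theta>" "0 < h"
    then show "mgf (\<theta> + h) \<le> mgf \<theta> + h * (2 * v * (\<theta> + h) * mgf (\<theta> + h))"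
      using mgf_step[of \<theta> h]
        mult_left_mono[OF mgf_deriv_le[of "\<theta> + h"] less_imp_le[of 0 h]] by linarith
  qed
  also have "mgf 0 = real CARD('d)"
    by (simp add: mgf_def expX_def re_trace_mat_exp_0 prob_space)
  finally show ?thesis .
qed

end

section \<open>Matrix norms and expectations\<close>

lemma norm_matrix_vector_le_op_norm: "norm (A *v x) \<le> op_norm A * norm x"
  unfolding op_norm_def by (rule onorm[OF bounded_linear_matrix_vector])

lemma norm_axis_one: "norm (axis j 1 :: complex^'d) = 1"
  by (simp add: norm_eq_1 inner_axis_axis)

text \<open>
  Passes from the quadratic forms of a squared difference to the norm of the matrix type.
\<close>

lemma norm_matrix_le_columns:
  fixes A :: "complex^'d^'d"
  shows "norm A \<le> real CARD('d) * (\<Sum>j\<in>UNIV. norm (A *v axis j 1))"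
proof -
  have entry: "norm (A $ i $ j) \<le> norm (A *v axis j 1)" for i j
  proof -
    have "(A *v axis j 1) $ i = A $ i $ j"
      by (simp add: matrix_vector_mult_def axis_def if_distrib[of "(*) _"] cong: if_cong)
    then show ?thesis using Finite_Cartesian_Product.norm_nth_le[of "A *v axis j 1" i] by simp
  qed
  have "norm A \<le> (\<Sum>i\<in>UNIV. norm (A $ i))"
    unfolding norm_vec_def by (rule L2_set_le_sum) simp
  also have "\<dots> \<le> (\<Sum>i\<in>UNIV. \<Sum>j\<in>UNIV. norm (A $ i $ j))"
    by (intro sum_mono) (simp add: norm_vec_def L2_set_le_sum)
  also have "\<dots> \<le> (\<Sum>i\<in>(UNIV :: 'd set). \<Sum>j\<in>UNIV. norm (A *v axis j 1))"
    by (intro sum_mono entry)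
  finally show ?thesis by simp
qed

lemma norm_matrix_le_op_norm:
  fixes A :: "complex^'d^'d"
  shows "norm A \<le> (real CARD('d))\<^sup>2 * op_norm A"
proof -
  have "norm A \<le> real CARD('d) * (\<Sum>j\<in>UNIV. norm (A *v axis j 1))"
    by (rule norm_matrix_le_columns)
  also have "\<dots> \<le> real CARD('d) * (\<Sum>j\<in>(UNIV :: 'd set). op_norm A)"
    using norm_matrix_vector_le_op_norm[of A "axis _ 1"]
    by (intro mult_left_mono sum_mono) (auto simp: norm_axis_one)
  finally show ?thesis by (simp add: power2_eq_square)
qed

lemma mat_expectation_eq_integral:
  fixes F :: "'a \<Rightarrow> complex^'d^'d"
  assumes "integrable N F"
  shows "mat_expectation N F = integral\<^sup>L N F"
proof -
  have entry: "bounded_linear (\<lambda>A :: complex^'d^'d. A $ i $ j)" for i j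
    by (rule bounded_linear_compose[OF bounded_linear_vec_nth bounded_linear_vec_nth])
  show ?thesis
    by (simp add: vec_eq_iff mat_expectation_def integral_bounded_linear[OF entry assms])
qed

lemma hermitian_mat_expectation:
  assumes "\<And>z. z \<in> space N \<Longrightarrow> hermitian_mat (F z)"
  shows "hermitian_mat (mat_expectation N F)"
proof (rule hermitian_matI)
  fix i j
  have "cnj (mat_expectation N F $ j $ i) = (\<integral>z. cnj (F z $ j $ i) \<partial>N)"
    by (simp add: mat_expectation_def)
  also have "\<dots> = (\<integral>z. F z $ i $ j \<partial>N)"
    by (rule Bochner_Integration.integral_cong) (simp_all add: hermitian_matD assms)
  finally show "cnj (mat_expectation N F $ j $ i) = mat_expectation N F $ i $ j"
    by (simp add: mat_expectation_def)
qed

lemma suitable_integrable_norm_square: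
  fixes f :: "(nat \<Rightarrow> 'a) \<Rightarrow> complex^'d^'d"
  assumes suitable_f: "suitable \<mu> f"
  shows "integrable \<mu> (\<lambda>z. (norm (f z))\<^sup>2)"
proof -
  have [measurable]: "f \<in> borel_measurable \<mu>" using suitable_f by (simp add: suitable_def)
  have "(\<integral>\<^sup>+z. ennreal ((norm (f z))\<^sup>2 / real CARD('d) ^ 4) \<partial>\<mu>) \<le> (\<integral>\<^sup>+z. ennreal ((op_norm (f z))\<^sup>2) \<partial>\<mu>)"
  proof (intro nn_integral_mono ennreal_leI)
    fix z
    have "(norm (f z))\<^sup>2 \<le> ((real CARD('d))\<^sup>2 * op_norm (f z))\<^sup>2"
      by (intro power_mono norm_matrix_le_op_norm) simp
    then show "(norm (f z))\<^sup>2 / real CARD('d) ^ 4 \<le> (op_norm (f z))\<^sup>2"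
      by (simp add: divide_le_eq power_mult_distrib mult.commute)
  qed
  also have "\<dots> < \<infinity>" using suitable_f by (simp add: suitable_def)
  finally have "integrable \<mu> (\<lambda>z. (norm (f z))\<^sup>2 / real CARD('d) ^ 4)"
    by (simp add: integrable_iff_bounded)
  from integrable_mult_left[OF this, of "real CARD('d) ^ 4"] show ?thesis by simp
qed

lemma suitable_integrable:
  fixes f :: "(nat \<Rightarrow> 'a) \<Rightarrow> complex^'d^'d"
  assumes prob: "prob_space \<mu>" and suitable_f: "suitable \<mu> f"
  shows "integrable \<mu> f"
proof (rule Bochner_Integration.integrable_bound)
  show "integrable \<mu> (\<lambda>z. 1 + (norm (f z))\<^sup>2)" 
  proof -
    interpret prob_space \<mu> by (rule prob)
    show ?thesis using suitable_integrable_norm_square[OF suitable_f] by simp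
  qed
  show "AE z in \<mu>. norm (f z) \<le> norm (1 + (norm (f z))\<^sup>2)"
  proof (rule AE_I2)
    fix z
    have "0 \<le> (norm (f z) - 1)\<^sup>2" by simp
    then show "norm (f z) \<le> norm (1 + (norm (f z))\<^sup>2)"
      using norm_ge_zero[of "f z"] by (simp add: power2_diff del: norm_ge_zero)
  qed
qed (use suitable_f in \<open>simp add: suitable_def\<close>)

section \<open>A bounded variance proxy forces boundedness\<close>

text \<open>
  The name \<open>I\<close> stands for the index set \<open>{1..n}\<close>, which the simplifier would rewrite to \<open>{Suc 0..n}\<close>.
\<close>

locale hermitian_field_variance =
  fixes n :: nat and I :: "nat set" and M :: "nat \<Rightarrow> 'a measure"
    and f :: "(nat \<Rightarrow> 'a) \<Rightarrow> complex^'d^'d" and v :: real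
  assumes index: "I = {1..n}"
    and prob_factor: "\<And>i. prob_space (M i)"
    and suitable_f: "suitable (PiM I M) f"
    and v_nonneg: "0 \<le> v"
    and proxy: "AE z in PiM I M. op_norm (matrix_variance n (PiM I M) f z) \<le> v"
begin

abbreviation \<mu> where "\<mu> \<equiv> PiM I M"

sublocale prob_space \<mu> by (rule prob_space_PiM) (rule prob_factor)

lemma finite_index: "finite I" by (simp add: index)
lemma card_index: "card I = n" by (simp add: index)

lemma measurable_f [measurable]: "f \<in> borel_measurable \<mu>"
  using suitable_f by (simp add: suitable_def)

lemma hermitian_f: "z \<in> space \<mu> \<Longrightarrow> hermitian_mat (f z)"
  using suitable_f by (simp add: suitable_def)

lemma update_eq_mix:
  assumes "z \<in> space \<mu>" "i \<in> I"
  shows "z(i := Y i) = mix I {i} z Y"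
  using assms by (simp add: mix_singleton space_PiM PiE_iff)

lemma measurable_update:
  assumes "z \<in> space \<mu>" "i \<in> I"
  shows "(\<lambda>Y. z(i := Y i)) \<in> \<mu> \<rightarrow>\<^sub>M \<mu>"
  unfolding update_eq_mix[OF assms] by (rule measurable_mix1[OF assms(1)])

lemma integrable_norm_f_square: "integrable \<mu> (\<lambda>z. (norm (f z))\<^sup>2)"
  by (rule suitable_integrable_norm_square[OF suitable_f])

lemma integrable_f: "integrable \<mu> f"
  by (rule suitable_integrable[OF prob_space_axioms suitable_f])

text \<open>
  Needed because the matrix variance is built from Bochner integrals, which are zero for a
  non-integrable integrand: only at points \<open>z\<close> as here does it dominate the resampling squares.
\<close>

lemma AE_integrable_update:
  "AE z in \<mu>. \<forall>i\<in>I. integrable \<mu> (\<lambda>Y. (norm (f (z(i := Y i))))\<^sup>2)"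
proof (rule AE_finite_allI[OF finite_index])
  fix i assume i: "i \<in> I"
  have meas: "(\<lambda>z. ennreal ((norm (f z))\<^sup>2)) \<in> borel_measurable \<mu>" by measurable
  have "(\<integral>\<^sup>+z. ennreal ((norm (f z))\<^sup>2) \<partial>\<mu>) < \<infinity>"
    using integrable_norm_f_square by (simp add: integrable_iff_bounded)
  then have "(\<integral>\<^sup>+z. (\<integral>\<^sup>+Y. ennreal ((norm (f (mix I {i} z Y)))\<^sup>2) \<partial>\<mu>) \<partial>\<mu>) < \<infinity>"
    unfolding nn_integral_mix(1)[OF finite_index prob_factor meas, of "{i}"] .
  then have "AE z in \<mu>. (\<integral>\<^sup>+Y. ennreal ((norm (f (mix I {i} z Y)))\<^sup>2) \<partial>\<mu>) \<noteq> \<infinity>"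
    by (intro nn_integral_PInf_AE nn_integral_mix(2)[OF finite_index prob_factor meas]) auto
  then show "AE z in \<mu>. integrable \<mu> (\<lambda>Y. (norm (f (z(i := Y i))))\<^sup>2)"
  proof (rule AE_mp, intro AE_I2 impI)
    fix z assume z: "z \<in> space \<mu>"
      and fin: "(\<integral>\<^sup>+Y. ennreal ((norm (f (mix I {i} z Y)))\<^sup>2) \<partial>\<mu>) \<noteq> \<infinity>"
    have "(\<lambda>Y. f (z(i := Y i))) \<in> borel_measurable \<mu>"
      by (rule measurable_compose[OF measurable_update[OF z i] measurable_f])
    then show "integrable \<mu> (\<lambda>Y. (norm (f (z(i := Y i))))\<^sup>2)"
      using fin unfolding update_eq_mix[OF z i]
      by (simp add: integrable_iff_bounded less_top)
  qed
qed

lemma integrable_square_diff: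
  assumes z: "z \<in> space \<mu>" and i: "i \<in> I"
    and int: "integrable \<mu> (\<lambda>Y. (norm (f (z(i := Y i))))\<^sup>2)"
  shows "integrable \<mu> (\<lambda>Y. (f z - f (z(i := Y i))) ** (f z - f (z(i := Y i))))"
proof -
  obtain C where C: "C > 0"
    "\<And>A B. norm ((A :: complex^'d^'d) ** (B :: complex^'d^'d)) \<le> norm A * norm B * C"
    using mmult.pos_bounded by blast
  have [measurable]: "(\<lambda>Y. f (z(i := Y i))) \<in> borel_measurable \<mu>"
    by (rule measurable_compose[OF measurable_update[OF z i] measurable_f])
  show ?thesis
  proof (rule Bochner_Integration.integrable_bound)
    show "integrable \<mu> (\<lambda>Y. (2 * (norm (f z))\<^sup>2 + 2 * (norm (f (z(i := Y i))))\<^sup>2) * C)"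
      using int by simp
    show "AE Y in \<mu>. norm ((f z - f (z(i := Y i))) ** (f z - f (z(i := Y i))))
        \<le> norm ((2 * (norm (f z))\<^sup>2 + 2 * (norm (f (z(i := Y i))))\<^sup>2) * C)"
    proof (rule AE_I2)
      fix Y
      let ?a = "norm (f z)" and ?b = "norm (f (z(i := Y i)))" and ?D = "f z - f (z(i := Y i))"
      have "norm ?D * norm ?D \<le> (?a + ?b) * (?a + ?b)"
        by (intro mult_mono norm_triangle_ineq4) auto
      also have "\<dots> \<le> 2 * ?a\<^sup>2 + 2 * ?b\<^sup>2"
        using zero_le_power2[of "?a - ?b"] by (simp add: power2_eq_square algebra_simps)
      finally have "norm ?D * norm ?D * C \<le> (2 * ?a\<^sup>2 + 2 * ?b\<^sup>2) * C"
        using C(1) by (intro mult_right_mono) auto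
      then show "norm (?D ** ?D) \<le> norm ((2 * ?a\<^sup>2 + 2 * ?b\<^sup>2) * C)"
        using C(2)[of ?D ?D] abs_ge_self[of "(2 * ?a\<^sup>2 + 2 * ?b\<^sup>2) * C"] by simp
    qed
  qed measurable
qed

lemma variance_quadratic_form:
  "AE z in \<mu>. \<forall>x. 1 / 2 * (\<Sum>i\<in>I. \<integral>Y. (norm ((f z - f (z(i := Y i))) *v x))\<^sup>2 \<partial>\<mu>) \<le> v * (norm x)\<^sup>2"
  using proxy AE_integrable_update
proof (rule AE_mp[OF AE_conjI], intro AE_I2 impI allI)
  fix z x assume z: "z \<in> space \<mu>"
    and *: "op_norm (matrix_variance n \<mu> f z) \<le> v \<and>
      (\<forall>i\<in>I. integrable \<mu> (\<lambda>Y. (norm (f (z(i := Y i))))\<^sup>2))"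
  let ?D = "\<lambda>i Y. f z - f (z(i := Y i))"
  have bl: "bounded_linear (\<lambda>A :: complex^'d^'d. x \<bullet> (A *v x))"
    by (rule bounded_linear_compose[OF bounded_linear_inner_right bounded_linear_apply_vector])
  interpret bl: bounded_linear "\<lambda>A :: complex^'d^'d. x \<bullet> (A *v x)" by (rule bl)
  have each: "x \<bullet> (mat_expectation \<mu> (\<lambda>Y. ?D i Y ** ?D i Y) *v x) = (\<integral>Y. (norm (?D i Y *v x))\<^sup>2 \<partial>\<mu>)"
    if i: "i \<in> I" for i
  proof -
    have int: "integrable \<mu> (\<lambda>Y. ?D i Y ** ?D i Y)"
      using * i by (intro integrable_square_diff z) auto
    have "x \<bullet> (mat_expectation \<mu> (\<lambda>Y. ?D i Y ** ?D i Y) *v x) = (\<integral>Y. x \<bullet> ((?D i Y ** ?D i Y) *v x) \<partial>\<mu>)"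
      unfolding mat_expectation_eq_integral[OF int] by (rule integral_bounded_linear[OF bl int, symmetric])
    also have "\<dots> = (\<integral>Y. (norm (?D i Y *v x))\<^sup>2 \<partial>\<mu>)"
    proof (rule Bochner_Integration.integral_cong[OF refl])
      fix Y assume "Y \<in> space \<mu>"
      then have "z(i := Y i) \<in> space \<mu>" using measurable_space[OF measurable_update[OF z i]] by simp
      then show "x \<bullet> ((?D i Y ** ?D i Y) *v x) = (norm (?D i Y *v x))\<^sup>2"
        by (intro hermitian_mat_square_inner hermitian_mat_diff hermitian_f z)
    qed
    finally show ?thesis .
  qed
  have "1 / 2 * (\<Sum>i\<in>I. \<integral>Y. (norm (?D i Y *v x))\<^sup>2 \<partial>\<mu>) = x \<bullet> (matrix_variance n \<mu> f z *v x)"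
    unfolding matrix_variance_def bl.scaleR bl.sum index[symmetric] by (simp add: each)
  also have "\<dots> \<le> norm x * norm (matrix_variance n \<mu> f z *v x)" by (rule norm_cauchy_schwarz)
  also have "\<dots> \<le> norm x * (op_norm (matrix_variance n \<mu> f z) * norm x)"
    by (intro mult_left_mono norm_matrix_vector_le_op_norm) simp
  also have "\<dots> \<le> norm x * (v * norm x)"
    using * by (intro mult_left_mono mult_right_mono) auto
  finally show "1 / 2 * (\<Sum>i\<in>I. \<integral>Y. (norm (?D i Y *v x))\<^sup>2 \<partial>\<mu>) \<le> v * (norm x)\<^sup>2"
    by (simp add: power2_eq_square mult_ac)
qed

text \<open>
  Bounds the mean change of \<open>f\<close> under resampling of one coordinate: each of the \<open>d\<close> columns \<open>x\<close> of a
  difference satisfies \<open>|x| \<le> 1 + |x|\<^sup>2\<close>, and the mean of \<open>|x|\<^sup>2\<close> is at most \<open>2 v\<close>. The remaining factor \<open>d\<close>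
  comes from the norm comparison \<open>norm_matrix_le_columns\<close>.
\<close>

definition resample_bound :: real where
  "resample_bound = (real CARD('d))\<^sup>2 * (1 + 2 * v)"

lemma resample_bound_nonneg: "0 \<le> resample_bound"
  using v_nonneg by (simp add: resample_bound_def)

lemma resample_one_bound:
  "AE z in \<mu>. \<forall>i\<in>I. (\<integral>\<^sup>+Y. ennreal (norm (f z - f (z(i := Y i)))) \<partial>\<mu>) \<le> ennreal resample_bound"
  using variance_quadratic_form AE_integrable_update
proof (rule AE_mp[OF AE_conjI], intro AE_I2 impI ballI)
  fix z i assume z: "z \<in> space \<mu>" and i: "i \<in> I"
    and *: "(\<forall>x. 1 / 2 * (\<Sum>i\<in>I. \<integral>Y. (norm ((f z - f (z(i := Y i))) *v x))\<^sup>2 \<partial>\<mu>) \<le> v * (norm x)\<^sup>2) \<and>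
      (\<forall>i\<in>I. integrable \<mu> (\<lambda>Y. (norm (f (z(i := Y i))))\<^sup>2))"
  let ?D = "\<lambda>Y. f z - f (z(i := Y i))"
  let ?col = "\<lambda>j Y. (norm (?D Y *v axis j 1))\<^sup>2"
  have [measurable]: "?D \<in> borel_measurable \<mu>"
    using measurable_compose[OF measurable_update[OF z i] measurable_f] by simp
  have int: "integrable \<mu> (?col j)" for j
  proof -
    have "integrable \<mu> (\<lambda>Y. ?D Y ** ?D Y)"
      using * i by (intro integrable_square_diff z) auto
    then have "integrable \<mu> (\<lambda>Y. axis j 1 \<bullet> ((?D Y ** ?D Y) *v axis j 1))"
      by (intro integrable_bounded_linear[OF
            bounded_linear_compose[OF bounded_linear_inner_right bounded_linear_apply_vector]])
    then show ?thesis
    proof (rule Bochner_Integration.integrable_cong[OF refl, THEN iffD1, rotated -1])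
      fix Y assume "Y \<in> space \<mu>"
      then have "z(i := Y i) \<in> space \<mu>" using measurable_space[OF measurable_update[OF z i]] by simp
      then show "axis j 1 \<bullet> ((?D Y ** ?D Y) *v axis j 1) = ?col j Y"
        by (intro hermitian_mat_square_inner hermitian_mat_diff hermitian_f z)
    qed
  qed
  have int_col: "(\<integral>Y. ?col j Y \<partial>\<mu>) \<le> 2 * v" for j
  proof -
    have "(\<integral>Y. ?col j Y \<partial>\<mu>) \<le> (\<Sum>i\<in>I. \<integral>Y. (norm ((f z - f (z(i := Y i))) *v axis j 1))\<^sup>2 \<partial>\<mu>)"
      using i by (intro member_le_sum[OF _ _ finite_index, where f = "\<lambda>i. \<integral>Y. (norm ((f z - f (z(i := Y i))) *v axis j 1))\<^sup>2 \<partial>\<mu>"]) auto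
    also have "\<dots> \<le> 2 * v" using *[THEN conjunct1, rule_format, of "axis j 1"] by (simp add: norm_axis_one)
    finally show ?thesis .
  qed
  have bound: "norm (?D Y) \<le> real CARD('d) * (\<Sum>j\<in>UNIV. 1 + ?col j Y)" for Y
  proof -
    have "norm (?D Y *v axis j 1) \<le> 1 + ?col j Y" for j
      using zero_le_power2[of "norm (?D Y *v axis j 1) - 1"] norm_ge_zero[of "?D Y *v axis j 1"]
      by (simp add: power2_diff del: norm_ge_zero)
    then show ?thesis
      by (intro order_trans[OF norm_matrix_le_columns] mult_left_mono sum_mono) auto
  qed
  have "(\<integral>\<^sup>+Y. ennreal (norm (?D Y)) \<partial>\<mu>)
      \<le> (\<integral>\<^sup>+Y. ennreal (real CARD('d) * (\<Sum>j\<in>UNIV. 1 + ?col j Y)) \<partial>\<mu>)"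
    by (intro nn_integral_mono ennreal_leI bound)
  also have "\<dots> = ennreal (\<integral>Y. real CARD('d) * (\<Sum>j\<in>UNIV. 1 + ?col j Y) \<partial>\<mu>)"
    using int by (intro nn_integral_eq_integral AE_I2 mult_nonneg_nonneg sum_nonneg add_nonneg_nonneg) auto
  also have "\<dots> \<le> ennreal resample_bound"
  proof (rule ennreal_leI)
    have "(\<integral>Y. real CARD('d) * (\<Sum>j\<in>UNIV. 1 + ?col j Y) \<partial>\<mu>)
        = real CARD('d) * (\<Sum>j\<in>UNIV. 1 + (\<integral>Y. ?col j Y \<partial>\<mu>))"
      using int by (simp add: prob_space)
    also have "\<dots> \<le> real CARD('d) * (\<Sum>j\<in>(UNIV :: 'd set). 1 + 2 * v)"
      by (intro mult_left_mono sum_mono add_left_mono int_col) simp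
    finally show "(\<integral>Y. real CARD('d) * (\<Sum>j\<in>UNIV. 1 + ?col j Y) \<partial>\<mu>) \<le> resample_bound"
      by (simp add: resample_bound_def power2_eq_square)
  qed
  finally show "(\<integral>\<^sup>+Y. ennreal (norm (?D Y)) \<partial>\<mu>) \<le> ennreal resample_bound" .
qed

text \<open>
  To resample \<open>S \<union> {i}\<close>, first resample coordinate \<open>i\<close> and then \<open>S\<close>. The first move costs at most
  \<open>resample_bound\<close>; the second starts from a point with the law \<open>\<mu>\<close>, where the induction hypothesis
  holds almost surely, and uses coordinates independent of that point.
\<close>

lemma resample_many_bound:
  assumes "S \<subseteq> I"
  shows "AE z in \<mu>. (\<integral>\<^sup>+Y. ennreal (norm (f z - f (mix I S z Y))) \<partial>\<mu>) \<le> ennreal (real (card S) * resample_bound)"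
  using finite_subset[OF assms finite_index] assms
proof (induction S rule: finite_induct)
  case empty
  have "mix I {} z Y = z" if "z \<in> space \<mu>" for z Y
    using that by (auto simp: mix_def space_PiM PiE_iff extensional_def fun_eq_iff)
  then show ?case by (intro AE_I2) simp
next
  case (insert i S)
  have i: "i \<in> I" "i \<notin> S" using insert by auto
  have IH: "AE z in \<mu>. (\<integral>\<^sup>+Y. ennreal (norm (f z - f (mix I S z Y))) \<partial>\<mu>) \<le> ennreal (real (card S) * resample_bound)"
    using insert by simp
  have IH': "AE z in \<mu>. AE Y in \<mu>. (\<integral>\<^sup>+Y'. ennreal (norm (f (mix I {i} z Y) -
      f (mix I S (mix I {i} z Y) Y'))) \<partial>\<mu>) \<le> ennreal (real (card S) * resample_bound)"
    by (rule AE_mix[OF finite_index prob_factor IH])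
  show ?case
    using resample_one_bound IH'
  proof (rule AE_mp[OF AE_conjI], intro AE_I2 impI)
    fix z assume z: "z \<in> space \<mu>"
      and *: "(\<forall>i\<in>I. (\<integral>\<^sup>+Y. ennreal (norm (f z - f (z(i := Y i)))) \<partial>\<mu>) \<le> ennreal resample_bound) \<and>
        (AE Y in \<mu>. (\<integral>\<^sup>+Y'. ennreal (norm (f (mix I {i} z Y) -
          f (mix I S (mix I {i} z Y) Y'))) \<partial>\<mu>) \<le> ennreal (real (card S) * resample_bound))"
    let ?w = "\<lambda>Y. mix I {i} z Y"
    have mix: "mix I (insert i S) z Y = mix I S (?w Y) Y" for Y
      using i by (auto simp: mix_def fun_eq_iff)
    have w_mix: "?w (mix I S Y Y') = ?w Y" "mix I S (?w Y) (mix I S Y Y') = mix I S (?w Y) Y'" for Y Y'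
      using i by (auto simp: mix_def fun_eq_iff)
    have m1: "(\<lambda>Y. f (?w Y)) \<in> borel_measurable \<mu>"
      by (rule measurable_compose[OF measurable_mix1[OF z] measurable_f])
    have m2: "(\<lambda>Y. f (mix I S (?w Y) Y)) \<in> borel_measurable \<mu>"
      unfolding mix[symmetric] by (rule measurable_compose[OF measurable_mix1[OF z] measurable_f])
    have "(\<integral>\<^sup>+Y. ennreal (norm (f z - f (mix I (insert i S) z Y))) \<partial>\<mu>)
        \<le> (\<integral>\<^sup>+Y. ennreal (norm (f z - f (?w Y))) + ennreal (norm (f (?w Y) - f (mix I S (?w Y) Y))) \<partial>\<mu>)"
    proof (intro nn_integral_mono)
      fix Y
      have "norm (f z - f (mix I S (?w Y) Y)) \<le> norm (f z - f (?w Y)) + norm (f (?w Y) - f (mix I S (?w Y) Y))"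
        using norm_triangle_ineq[of "f z - f (?w Y)" "f (?w Y) - f (mix I S (?w Y) Y)"] by simp
      then show "ennreal (norm (f z - f (mix I (insert i S) z Y)))
          \<le> ennreal (norm (f z - f (?w Y))) + ennreal (norm (f (?w Y) - f (mix I S (?w Y) Y)))"
        unfolding mix by (simp add: ennreal_leI flip: ennreal_plus)
    qed
    also have "\<dots> = (\<integral>\<^sup>+Y. ennreal (norm (f z - f (?w Y))) \<partial>\<mu>)
        + (\<integral>\<^sup>+Y. ennreal (norm (f (?w Y) - f (mix I S (?w Y) Y))) \<partial>\<mu>)"
      using m1 m2 by (intro nn_integral_add) auto
    also have "\<dots> \<le> ennreal resample_bound + ennreal (real (card S) * resample_bound)"
    proof (rule add_mono)
      show "(\<integral>\<^sup>+Y. ennreal (norm (f z - f (?w Y))) \<partial>\<mu>) \<le> ennreal resample_bound"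
        using * i(1) by (simp only: update_eq_mix[OF z i(1), symmetric])
      have "(\<integral>\<^sup>+Y. ennreal (norm (f (?w Y) - f (mix I S (?w Y) Y))) \<partial>\<mu>)
          = (\<integral>\<^sup>+Y. \<integral>\<^sup>+Y'. ennreal (norm (f (?w Y) - f (mix I S (?w Y) Y'))) \<partial>\<mu> \<partial>\<mu>)"
        using nn_integral_mix(1)[where J = I and M = M and S = S
            and g = "\<lambda>Y. ennreal (norm (f (?w Y) - f (mix I S (?w Y) Y)))"] m1 m2
        by (simp add: w_mix prob_factor finite_index)
      also have "\<dots> \<le> (\<integral>\<^sup>+Y. ennreal (real (card S) * resample_bound) \<partial>\<mu>)"
        using * by (intro nn_integral_mono_AE) auto
      also have "\<dots> = ennreal (real (card S) * resample_bound)" by (simp add: emeasure_space_1)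
      finally show "(\<integral>\<^sup>+Y. ennreal (norm (f (?w Y) - f (mix I S (?w Y) Y))) \<partial>\<mu>) \<le> ennreal (real (card S) * resample_bound)" .
    qed
    also have "\<dots> = ennreal (real (card (insert i S)) * resample_bound)"
      using insert(1) i(2) resample_bound_nonneg by (simp add: algebra_simps flip: ennreal_plus)
    finally show "(\<integral>\<^sup>+Y. ennreal (norm (f z - f (mix I (insert i S) z Y))) \<partial>\<mu>)
        \<le> ennreal (real (card (insert i S)) * resample_bound)" .
  qed
qed

definition centered :: "(nat \<Rightarrow> 'a) \<Rightarrow> complex^'d^'d" where
  "centered z = f z - mat_expectation \<mu> f"

text \<open>
  Resampling all coordinates replaces \<open>z\<close> by an independent point, over which \<open>f\<close> averages to its mean.
\<close>

lemma centered_bounded: "AE z in \<mu>. norm (centered z) \<le> real n * resample_bound"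
proof -
  have "AE z in \<mu>. (\<integral>\<^sup>+Y. ennreal (norm (f z - f (mix I I z Y))) \<partial>\<mu>) \<le> ennreal (real n * resample_bound)"
    using resample_many_bound[of I] by (simp add: card_index)
  then show ?thesis
  proof (rule AE_mp, intro AE_I2 impI)
    fix z assume "z \<in> space \<mu>"
      and le: "(\<integral>\<^sup>+Y. ennreal (norm (f z - f (mix I I z Y))) \<partial>\<mu>) \<le> ennreal (real n * resample_bound)"
    have "mix I I z Y = Y" if "Y \<in> space \<mu>" for Y
      using that by (auto simp: mix_def space_PiM PiE_iff extensional_def fun_eq_iff)
    then have "(\<integral>\<^sup>+Y. ennreal (norm (f z - f (mix I I z Y))) \<partial>\<mu>) = (\<integral>\<^sup>+Y. ennreal (norm (f z - f Y)) \<partial>\<mu>)"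
      by (intro nn_integral_cong) simp
    with le have le': "(\<integral>\<^sup>+Y. ennreal (norm (f z - f Y)) \<partial>\<mu>) \<le> ennreal (real n * resample_bound)" by simp
    have int: "integrable \<mu> (\<lambda>Y. f z - f Y)" using integrable_f by simp
    have "centered z = (\<integral>Y. f z - f Y \<partial>\<mu>)"
      using integrable_f by (simp add: centered_def mat_expectation_eq_integral prob_space)
    then have "norm (centered z) \<le> (\<integral>Y. norm (f z - f Y) \<partial>\<mu>)"
      using integral_norm_bound[of \<mu> "\<lambda>Y. f z - f Y"] by simp
    also have "\<dots> \<le> real n * resample_bound"
    proof -
      have "ennreal (\<integral>Y. norm (f z - f Y) \<partial>\<mu>) \<le> ennreal (real n * resample_bound)"
        using le' int by (subst nn_integral_eq_integral[symmetric]) auto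
      then show ?thesis using resample_bound_nonneg by (simp add: ennreal_le_iff)
    qed
    finally show "norm (centered z) \<le> real n * resample_bound" .
  qed
qed

lemma hermitian_centered: "z \<in> space \<mu> \<Longrightarrow> hermitian_mat (centered z)"
  unfolding centered_def by (intro hermitian_mat_diff hermitian_f hermitian_mat_expectation)

lemma measurable_centered [measurable]: "centered \<in> borel_measurable \<mu>"
  unfolding centered_def[abs_def] by measurable

text \<open>
  A version of the centred field that is bounded everywhere, not only almost everywhere.
\<close>

definition truncated :: "(nat \<Rightarrow> 'a) \<Rightarrow> complex^'d^'d" where
  "truncated z = (if norm (centered z) \<le> real n * resample_bound then centered z else 0)"

lemma measurable_truncated [measurable]: "truncated \<in> borel_measurable \<mu>"
  unfolding truncated_def[abs_def] by measurable

lemma AE_truncated: "AE z in \<mu>. truncated z = centered z"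
  using centered_bounded by (rule AE_mp) (simp add: truncated_def)

text \<open>
  Truncation changes the field on a null set only. By Fubini's theorem, for almost every \<open>z\<close> it leaves
  the values at almost all resampled points unchanged too, so the variance bound survives.
\<close>

lemma bounded_truncated: "bounded_hermitian_field I M truncated v"
proof (rule bounded_hermitian_field.intro)
  show "finite I" "0 \<le> v" by (rule finite_index, rule v_nonneg)
  show "prob_space (M i)" for i by (rule prob_factor)
  show "bounded_measurable \<mu> truncated"
    using resample_bound_nonneg by (intro bounded_measurableI[where K = "real n * resample_bound"]) (auto simp: truncated_def)
  show "hermitian_mat (truncated z)" if "z \<in> space \<mu>" for z
    using hermitian_centered[OF that] by (auto simp: truncated_def intro: hermitian_matI)
  have "integral\<^sup>L \<mu> truncated = integral\<^sup>L \<mu> centered"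
    by (rule integral_cong_AE[OF _ _ AE_truncated]) measurable
  also have "\<dots> = 0"
    using integrable_f by (simp add: centered_def[abs_def] mat_expectation_eq_integral prob_space)
  finally show "integral\<^sup>L \<mu> truncated = 0" .
  have "AE z in \<mu>. \<forall>i\<in>I. AE Y in \<mu>. truncated (mix I {i} z Y) = centered (mix I {i} z Y)"
    by (intro AE_finite_allI finite_index AE_mix[OF finite_index prob_factor AE_truncated])
  from AE_conjI[OF AE_truncated AE_conjI[OF this variance_quadratic_form]]
  show "AE z in \<mu>. \<forall>x. 1 / 2 * (\<Sum>i\<in>I. \<integral>Y. (norm ((truncated z - truncated (z(i := Y i))) *v x))\<^sup>2 \<partial>\<mu>)
      \<le> v * (norm x)\<^sup>2"
  proof (rule AE_mp, intro AE_I2 impI allI)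
    fix z x assume z: "z \<in> space \<mu>"
      and *: "truncated z = centered z \<and>
        (\<forall>i\<in>I. AE Y in \<mu>. truncated (mix I {i} z Y) = centered (mix I {i} z Y)) \<and>
        (\<forall>x. 1 / 2 * (\<Sum>i\<in>I. \<integral>Y. (norm ((f z - f (z(i := Y i))) *v x))\<^sup>2 \<partial>\<mu>) \<le> v * (norm x)\<^sup>2)"
    have "(\<integral>Y. (norm ((truncated z - truncated (z(i := Y i))) *v x))\<^sup>2 \<partial>\<mu>)
        = (\<integral>Y. (norm ((f z - f (z(i := Y i))) *v x))\<^sup>2 \<partial>\<mu>)" if i: "i \<in> I" for i
    proof (rule integral_cong_AE)
      note [measurable] = measurable_compose[OF measurable_update[OF z i] measurable_f]
        measurable_compose[OF measurable_update[OF z i] measurable_truncated]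
      have [measurable]: "(\<lambda>A :: complex^'d^'d. A *v x) \<in> borel_measurable borel"
        by (intro borel_measurable_continuous_onI linear_continuous_on bounded_linear_apply_vector)
      show "(\<lambda>Y. (norm ((truncated z - truncated (z(i := Y i))) *v x))\<^sup>2) \<in> borel_measurable \<mu>"
        by measurable
      show "(\<lambda>Y. (norm ((f z - f (z(i := Y i))) *v x))\<^sup>2) \<in> borel_measurable \<mu>"
        by measurable
      have "AE Y in \<mu>. truncated (mix I {i} z Y) = centered (mix I {i} z Y)" using * i by blast
      then show "AE Y in \<mu>. (norm ((truncated z - truncated (z(i := Y i))) *v x))\<^sup>2 =
          (norm ((f z - f (z(i := Y i))) *v x))\<^sup>2"
      proof (rule AE_mp, intro AE_I2 impI)
        fix Y assume "truncated (mix I {i} z Y) = centered (mix I {i} z Y)"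
        then have "truncated z - truncated (z(i := Y i)) = f z - f (z(i := Y i))"
          using * update_eq_mix[OF z i, of Y] by (simp add: centered_def)
        then show "(norm ((truncated z - truncated (z(i := Y i))) *v x))\<^sup>2 =
          (norm ((f z - f (z(i := Y i))) *v x))\<^sup>2" by simp
      qed
    qed
    then show "1 / 2 * (\<Sum>i\<in>I. \<integral>Y. (norm ((truncated z - truncated (z(i := Y i))) *v x))\<^sup>2 \<partial>\<mu>)
      \<le> v * (norm x)\<^sup>2" using * by simp
  qed
qed

lemma trace_mgf_bound:
  assumes "0 \<le> \<theta>"
  shows "integrable \<mu> (\<lambda>z. re_trace (mat_exp (\<theta> *\<^sub>R centered z)))"
    and "(\<integral>z. re_trace (mat_exp (\<theta> *\<^sub>R centered z)) \<partial>\<mu>) \<le> real CARD('d) * exp (v * \<theta>\<^sup>2)"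
proof -
  interpret X: bounded_hermitian_field I M truncated v by (rule bounded_truncated)
  have tr: "(re_trace :: complex^'d^'d \<Rightarrow> real) \<in> borel_measurable borel"
    by (intro borel_measurable_continuous_onI linear_continuous_on bounded_linear_re_trace)
  have meas: "(\<lambda>z. re_trace (mat_exp (\<theta> *\<^sub>R F z))) \<in> borel_measurable \<mu>"
    if "F \<in> borel_measurable \<mu>" for F :: "(nat \<Rightarrow> 'a) \<Rightarrow> complex^'d^'d"
    using borel_measurable_mat_exp[OF borel_measurable_scaleR[OF borel_measurable_const that]]
    by (rule measurable_compose) (rule tr)
  have ae: "AE z in \<mu>. re_trace (mat_exp (\<theta> *\<^sub>R truncated z)) = re_trace (mat_exp (\<theta> *\<^sub>R centered z))"
    using AE_truncated by (rule AE_mp) simp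
  have "integrable \<mu> (\<lambda>z. re_trace (mat_exp (\<theta> *\<^sub>R truncated z)))"
    by (rule bounded_measurable_integrable[OF prob_space_axioms bounded_measurable_bounded_linear[OF
            bounded_linear_re_trace X.bounded_expX[of \<theta>, unfolded X.expX_def[abs_def]]]])
  then show "integrable \<mu> (\<lambda>z. re_trace (mat_exp (\<theta> *\<^sub>R centered z)))"
    by (rule integrable_cong_AE_imp[OF _ _ ae]) (rule meas, rule measurable_centered)
  have "(\<integral>z. re_trace (mat_exp (\<theta> *\<^sub>R centered z)) \<partial>\<mu>) = X.mgf \<theta>"
    unfolding X.mgf_def X.expX_def
    by (rule integral_cong_AE[OF _ _ ae, symmetric]) (rule meas, rule measurable_truncated measurable_centered)+
  then show "(\<integral>z. re_trace (mat_exp (\<theta> *\<^sub>R centered z)) \<partial>\<mu>) \<le> real CARD('d) * exp (v * \<theta>\<^sup>2)"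
    using X.mgf_le[OF assms] by simp
qed

lemma eigenvalue_tail:
  assumes eig: "\<And>z. z \<in> space \<mu> \<Longrightarrow> is_eigenvalue (centered z) (complex_of_real (eig z))"
    and \<theta>: "0 \<le> \<theta>"
  shows "measure \<mu> {z \<in> space \<mu>. t \<le> eig z} \<le> real CARD('d) * exp (v * \<theta>\<^sup>2 - \<theta> * t)"
proof -
  note int = trace_mgf_bound(1)[OF \<theta>]
  have "{z \<in> space \<mu>. t \<le> eig z} \<subseteq> {z \<in> space \<mu>. exp (\<theta> * t) \<le> re_trace (mat_exp (\<theta> *\<^sub>R centered z))}"
  proof safe
    fix z assume z: "z \<in> space \<mu>" and "t \<le> eig z"
    then have "exp (\<theta> * t) \<le> exp (\<theta> * eig z)" using \<theta> by (simp add: mult_left_mono)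
    also have "\<dots> \<le> re_trace (mat_exp (\<theta> *\<^sub>R centered z))"
      by (rule exp_eigenvalue_le_re_trace[OF hermitian_centered[OF z] eig[OF z]])
    finally show "exp (\<theta> * t) \<le> re_trace (mat_exp (\<theta> *\<^sub>R centered z))" .
  qed
  then have "measure \<mu> {z \<in> space \<mu>. t \<le> eig z}
      \<le> measure \<mu> {z \<in> space \<mu>. exp (\<theta> * t) \<le> re_trace (mat_exp (\<theta> *\<^sub>R centered z))}"
    using borel_measurable_integrable[OF int] by (intro finite_measure_mono) auto
  also have "\<dots> \<le> (\<integral>z. re_trace (mat_exp (\<theta> *\<^sub>R centered z)) \<partial>\<mu>) / exp (\<theta> * t)"
    using int by (intro integral_Markov_inequality_measure[where A = "{}"])
      (auto intro!: AE_I2 re_trace_mat_exp_nonneg hermitian_mat_scaleR hermitian_centered)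
  also have "\<dots> \<le> real CARD('d) * exp (v * \<theta>\<^sup>2) / exp (\<theta> * t)"
    by (intro divide_right_mono trace_mgf_bound(2) \<theta>) simp
  also have "\<dots> = real CARD('d) * exp (v * \<theta>\<^sup>2 - \<theta> * t)" by (simp add: exp_diff)
  finally show ?thesis .
qed

text \<open>
  Jensen's inequality for the logarithm in tangent form: \<open>1 + y \<le> exp y\<close> at \<open>y = \<theta> \<lambda> - c\<close>, where
  \<open>exp c\<close> is the bound on the trace. A non-integrable selection of eigenvalues has integral \<open>0\<close> by
  convention, and the right-hand side is nonnegative.
\<close>

lemma eigenvalue_expectation:
  assumes eig: "\<And>z. z \<in> space \<mu> \<Longrightarrow> is_eigenvalue (centered z) (complex_of_real (eig z))"
    and \<theta>: "0 < \<theta>"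
  shows "\<theta> * integral\<^sup>L \<mu> eig \<le> ln (real CARD('d)) + v * \<theta>\<^sup>2"
proof (cases "integrable \<mu> eig")
  case True
  define c where "c = ln (real CARD('d)) + v * \<theta>\<^sup>2"
  have exp_c: "exp c = real CARD('d) * exp (v * \<theta>\<^sup>2)" by (simp add: c_def exp_add)
  note int = trace_mgf_bound(1)[of \<theta>] and bound = trace_mgf_bound(2)[of \<theta>]
  have "\<theta> * integral\<^sup>L \<mu> eig = (\<integral>z. \<theta> * eig z \<partial>\<mu>)" by simp
  also have "\<dots> \<le> (\<integral>z. c - 1 + exp (- c) * re_trace (mat_exp (\<theta> *\<^sub>R centered z)) \<partial>\<mu>)"
  proof (rule integral_mono)
    show "integrable \<mu> (\<lambda>z. \<theta> * eig z)" using True by simp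
    show "integrable \<mu> (\<lambda>z. c - 1 + exp (- c) * re_trace (mat_exp (\<theta> *\<^sub>R centered z)))"
      using int \<theta> by simp
    fix z assume z: "z \<in> space \<mu>"
    have "1 + (\<theta> * eig z - c) \<le> exp (\<theta> * eig z - c)" by (rule exp_ge_add_one_self)
    also have "\<dots> = exp (- c) * exp (\<theta> * eig z)" by (simp add: mult_exp_exp)
    also have "\<dots> \<le> exp (- c) * re_trace (mat_exp (\<theta> *\<^sub>R centered z))"
      by (intro mult_left_mono exp_eigenvalue_le_re_trace hermitian_centered eig z) simp
    finally show "\<theta> * eig z \<le> c - 1 + exp (- c) * re_trace (mat_exp (\<theta> *\<^sub>R centered z))" by simp
  qed
  also have "\<dots> = c - 1 + exp (- c) * (\<integral>z. re_trace (mat_exp (\<theta> *\<^sub>R centered z)) \<partial>\<mu>)"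
    using int \<theta> by (simp add: prob_space)
  also have "\<dots> \<le> c - 1 + exp (- c) * exp c"
    using bound \<theta> by (intro add_left_mono mult_left_mono) (auto simp: exp_c)
  also have "\<dots> = c" by (simp add: mult_exp_exp)
  finally show ?thesis by (simp add: c_def)
next
  case False
  have "1 \<le> real CARD('d)" by (simp add: Suc_le_eq)
  then show ?thesis using v_nonneg by (simp add: not_integrable_integral_eq[OF False])
qed

end

section \<open>Concentration of the extreme eigenvalues\<close>

text \<open>
  The best choice is \<open>\<theta> = E / (2 r)\<close>; for \<open>r = 0\<close> a large \<open>\<theta>\<close> excludes \<open>E > 0\<close>.
\<close>

lemma subgaussian_mean_bound:
  fixes E r L :: real
  assumes "\<And>\<theta>. 0 < \<theta> \<Longrightarrow> \<theta> * E \<le> L + r * \<theta>\<^sup>2" and r: "0 \<le> r" and L: "0 \<le> L"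
  shows "E \<le> 2 * sqrt (r * L)"
proof (cases "E \<le> 0")
  case True
  have "0 \<le> 2 * sqrt (r * L)" using r L by simp
  with True show ?thesis by linarith
next
  case False
  show ?thesis
  proof (cases "r = 0")
    case True
    then show ?thesis using False L assms(1)[of "(L + 1) / E"] by simp
  next
    case False': False
    then have "E / (2 * r) * E \<le> L + r * (E / (2 * r))\<^sup>2"
      using r False by (intro assms(1)) simp
    then have "E\<^sup>2 \<le> 4 * (r * L)"
      using r False' by (simp add: field_simps power2_eq_square)
    then have "E \<le> sqrt (4 * (r * L))" by (rule real_le_rsqrt)
    then show ?thesis by (simp add: real_sqrt_mult)
  qed
qed

text \<open>
  For \<open>v = 0\<close> the exponential bound holds without a quadratic term, and \<open>\<theta>\<close> can be taken arbitrarily large.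
\<close>

lemma subgaussian_tail_limit:
  fixes p d t :: real
  assumes le: "\<And>\<theta>. 0 \<le> \<theta> \<Longrightarrow> p \<le> d * exp (- (\<theta> * t))" and t: "0 < t"
  shows "p \<le> 0"
proof (rule ccontr)
  assume "\<not> p \<le> 0"
  then have p: "0 < p" by simp
  have pd: "p \<le> d" using le[of 0] by simp
  define \<theta> where "\<theta> = (ln (d / p) + 1) / t"
  have ln: "0 \<le> ln (d / p)" using p pd by simp
  then have "p \<le> d * exp (- (\<theta> * t))" using t by (intro le) (simp add: \<theta>_def)
  also have "\<theta> * t = ln (d / p) + 1" using t by (simp add: \<theta>_def)
  also have "d * exp (- (ln (d / p) + 1)) = p * exp (- 1)"
    using p pd by (simp add: exp_diff exp_minus field_simps)
  also have "\<dots> < p * 1" using p by (intro mult_strict_left_mono) auto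
  finally show False by simp
qed

lemma mat_expectation_uminus: "mat_expectation N (\<lambda>z. - F z) = - mat_expectation N F"
  by (simp add: mat_expectation_def vec_eq_iff)

lemma op_norm_nonneg: "0 \<le> op_norm A"
  unfolding op_norm_def by (rule onorm_pos_le[OF bounded_linear_matrix_vector])

lemma op_norm_uminus: "op_norm (- A) = op_norm A"
proof -
  have "(\<lambda>x. (- A) *v x) = (\<lambda>x. - (A *v x))"
    by (simp add: fun_eq_iff vec_eq_iff matrix_vector_mult_def sum_negf)
  then show ?thesis unfolding op_norm_def by (simp add: onorm_neg)
qed

lemma variance_proxy_uminus:
  fixes f :: "(nat \<Rightarrow> 'a) \<Rightarrow> complex^'d^'d"
  shows "variance_proxy n N (\<lambda>z. - f z) = variance_proxy n N f"
proof -
  have "(- a - - b) ** (- a - - b) = (a - b) ** (a - b)" for a b :: "complex^'d^'d"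
  proof -
    have "- a - - b = - (a - b)" by simp
    then show ?thesis by (simp only: mmult.minus_left mmult.minus_right minus_minus)
  qed
  then show ?thesis by (simp only: variance_proxy_def matrix_variance_def)
qed

lemma suitable_uminus:
  assumes "suitable N f"
  shows "suitable N (\<lambda>z. - f z)"
proof -
  have "hermitian_mat (- f z)" if "z \<in> space N" for z
    using assms that by (intro hermitian_matI) (simp add: suitable_def hermitian_matD)
  then show ?thesis using assms by (simp add: suitable_def op_norm_uminus)
qed

lemma exp_ereal_simps:
  "exp_ereal (ereal x) = ereal (exp x)" "exp_ereal 0 = 1" "exp_ereal (- \<infinity>) = 0"
  by (simp_all add: exp_ereal_def zero_ereal_def one_ereal_def)

lemma sqrt_ereal_0: "sqrt_ereal 0 = 0"
  by (simp add: sqrt_ereal_def zero_ereal_def)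

text \<open>
  The common form of the upper and the lower bounds, for an arbitrary selection of eigenvalues. An
  infinite proxy leaves one nontrivial case: for \<open>d = 1\<close> the bound on the mean is \<open>0\<close>, and the single
  eigenvalue, being the centred entry itself, has mean zero.
\<close>

lemma eigenvalue_concentration:
  fixes M :: "nat \<Rightarrow> 'a measure" and f :: "(nat \<Rightarrow> 'a) \<Rightarrow> complex^'d^'d" and v :: ereal
    and eig :: "(nat \<Rightarrow> 'a) \<Rightarrow> real"
  assumes prob: "\<And>i. prob_space (M i)" and \<mu>: "\<mu> = PiM {1..n} M"
    and f: "suitable \<mu> f" and v: "v = variance_proxy n \<mu> f"
    and eig: "\<And>z. z \<in> space \<mu> \<Longrightarrow> is_eigenvalue (f z - mat_expectation \<mu> f) (complex_of_real (eig z))"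
  shows "\<And>t. 0 \<le> t \<Longrightarrow> ereal (measure \<mu> {z \<in> space \<mu>. t \<le> eig z})
      \<le> ereal (real CARD('d)) * exp_ereal (- (ereal (t\<^sup>2) / (4 * v)))"
    and "ereal (integral\<^sup>L \<mu> eig) \<le> 2 * sqrt_ereal (v * ereal (ln (real CARD('d))))"
proof -
  interpret prob_space \<mu> unfolding \<mu> by (rule prob_space_PiM) (rule prob)
  let ?p = "\<lambda>t. measure \<mu> {z \<in> space \<mu>. t \<le> eig z}"
  have d1: "1 \<le> real CARD('d)" by (simp add: Suc_le_eq)
  have p_le_d: "?p t \<le> real CARD('d)" for t using prob_le_1 d1 by (rule order_trans)
  have AE_v: "AE z in \<mu>. ereal (op_norm (matrix_variance n \<mu> f z)) \<le> v"
    unfolding v variance_proxy_def by (rule esssup_AE)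
  then have "AE z in \<mu>. 0 \<le> v"
    by (rule AE_mp) (intro AE_I2 impI, metis op_norm_nonneg ereal_less_eq(5) order_trans)
  then have v_nonneg: "0 \<le> v" by simp
  have "(\<forall>t\<ge>0. ereal (?p t) \<le> ereal (real CARD('d)) * exp_ereal (- (ereal (t\<^sup>2) / (4 * v))))
    \<and> ereal (integral\<^sup>L \<mu> eig) \<le> 2 * sqrt_ereal (v * ereal (ln (real CARD('d))))"
  proof (cases v)
    case (real r)
    have r: "0 \<le> r" using v_nonneg real by simp
    interpret L: hermitian_field_variance n "{1..n}" M f r
    proof (rule hermitian_field_variance.intro)
      show "{1..n} = {1..n}" ..
      show "prob_space (M i)" for i by (rule prob)
      show "suitable (PiM {1..n} M) f" "0 \<le> r" using f r \<mu> by auto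
      show "AE z in PiM {1..n} M. op_norm (matrix_variance n (PiM {1..n} M) f z) \<le> r"
        using AE_v unfolding \<mu> real by simp
    qed
    have eig': "is_eigenvalue (L.centered z) (complex_of_real (eig z))" if "z \<in> space (PiM {1..n} M)" for z
      using eig that unfolding \<mu> L.centered_def by blast
    note tail = L.eigenvalue_tail[OF eig', folded \<mu>]
    have "?p t \<le> real CARD('d) * exp (- (t\<^sup>2 / (4 * r)))" if "0 < r" "0 \<le> t" for t
    proof -
      have "r * (t / (2 * r))\<^sup>2 - t / (2 * r) * t = - (t\<^sup>2 / (4 * r))"
        using that by (simp add: field_simps power2_eq_square)
      then show ?thesis using tail[of "t / (2 * r)" t] that by simp
    qed
    moreover have "?p t \<le> 0" if "r = 0" "0 < t" for t
      using tail that by (intro subgaussian_tail_limit[of _ "real CARD('d)" t]) auto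
    ultimately have "ereal (?p t) \<le> ereal (real CARD('d)) * exp_ereal (- (ereal (t\<^sup>2) / (4 * v)))" if "0 \<le> t" for t
      using that r p_le_d[of t] by (cases "r = 0"; cases "t = 0") (auto simp: real exp_ereal_simps)
    moreover have "integral\<^sup>L \<mu> eig \<le> 2 * sqrt (r * ln (real CARD('d)))"
      using L.eigenvalue_expectation[OF eig', folded \<mu>] r d1 by (intro subgaussian_mean_bound) auto
    ultimately show ?thesis by (simp add: real sqrt_ereal_def)
  next
    case PInf
    have "ereal (integral\<^sup>L \<mu> eig) \<le> 2 * sqrt_ereal (v * ereal (ln (real CARD('d))))"
    proof (cases "CARD('d) = 1")
      case True
      then obtain j :: 'd where j: "UNIV = {j}" by (auto simp: card_1_singleton_iff)
      have "eig z = Re (f z $ j $ j - mat_expectation \<mu> f $ j $ j)" if "z \<in> space \<mu>" for z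
      proof -
        let ?A = "f z - mat_expectation \<mu> f"
        obtain x where x: "x \<noteq> 0" "?A *v x = eig z *\<^sub>R x"
          using eig[OF \<open>z \<in> space \<mu>\<close>] by (auto simp: is_eigenvalue_of_real)
        have "x $ j \<noteq> 0"
        proof
          assume "x $ j = 0"
          then have "x $ i = 0" for i using j by (metis UNIV_I singletonD)
          with x(1) show False by (simp add: vec_eq_iff)
        qed
        moreover have "?A $ j $ j * x $ j = complex_of_real (eig z) * x $ j"
          using arg_cong[OF x(2), of "\<lambda>y. y $ j"]
          by (simp add: matrix_vector_mult_def j scaleR_conv_of_real[where 'a = complex])
        ultimately show ?thesis by simp
      qed
      then have "integral\<^sup>L \<mu> eig = (\<integral>z. Re (f z $ j $ j - mat_expectation \<mu> f $ j $ j) \<partial>\<mu>)"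
        by (intro Bochner_Integration.integral_cong) auto
      also have "\<dots> = 0"
      proof -
        have "integrable \<mu> (\<lambda>z. f z $ j $ j)"
          by (intro integrable_bounded_linear[OF bounded_linear_vec_nth]
              suitable_integrable[OF prob_space_axioms f])
        then show ?thesis by (simp add: mat_expectation_def prob_space)
      qed
      finally show ?thesis using True by (simp add: PInf sqrt_ereal_0)
    next
      case False
      moreover have "0 < CARD('d)" by simp
      ultimately have "1 < CARD('d)" by linarith
      then have "0 < ln (real CARD('d))" by simp
      then show ?thesis by (simp add: PInf sqrt_ereal_def)
    qed
    then show ?thesis using p_le_d by (simp add: PInf exp_ereal_simps)
  next
    case MInf
    then show ?thesis using v_nonneg by simp
  qed
  then show "\<And>t. 0 \<le> t \<Longrightarrow> ereal (?p t) \<le> ereal (real CARD('d)) * exp_ereal (- (ereal (t\<^sup>2) / (4 * v)))"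
    and "ereal (integral\<^sup>L \<mu> eig) \<le> 2 * sqrt_ereal (v * ereal (ln (real CARD('d))))" by blast+
qed

theorem corollary3p6:
  fixes n :: nat
    and T :: "nat \<Rightarrow> 'a topology"
    and M :: "nat \<Rightarrow> 'a measure"
    and \<mu> :: "(nat \<Rightarrow> 'a) measure"
    and f :: "(nat \<Rightarrow> 'a) \<Rightarrow> complex ^ 'd ^ 'd"
    and v :: ereal
    and g :: "(nat \<Rightarrow> 'a) \<Rightarrow> complex ^ 'd ^ 'd"
  assumes "n \<ge> 1"
    and "\<And>i. i \<in> {1..n} \<Longrightarrow> polish_topology (T i)"
    and "\<And>i. i \<in> {1..n} \<Longrightarrow> borel_prob_on (T i) (M i)"
    and "\<mu> = PiM {1..n} M"
    and "suitable \<mu> f"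
    and "v = variance_proxy n \<mu> f"
    and "g = (\<lambda>z. f z - mat_expectation \<mu> f)"
  shows "(\<forall>t\<ge>0. ereal (measure \<mu> {z \<in> space \<mu>. lambda_max (g z) \<ge> t})
            \<le> ereal (real CARD('d)) * exp_ereal (- (ereal (t\<^sup>2) / (4 * v))))
       \<and> ereal (integral\<^sup>L \<mu> (\<lambda>z. lambda_max (g z)))
            \<le> 2 * sqrt_ereal (v * ereal (ln (real CARD('d))))
       \<and> (\<forall>t\<ge>0. ereal (measure \<mu> {z \<in> space \<mu>. lambda_min (g z) \<le> - t})
            \<le> ereal (real CARD('d)) * exp_ereal (- (ereal (t\<^sup>2) / (4 * v))))
       \<and> ereal (integral\<^sup>L \<mu> (\<lambda>z. lambda_min (g z)))
            \<ge> - (2 * sqrt_ereal (v * ereal (ln (real CARD('d)))))"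
proof -
  \<comment> \<open>Factors outside \<open>{1..n}\<close> do not enter the product; this makes all of them probability measures.\<close>
  define M' where "M' = (\<lambda>i. if i \<in> {1..n} then M i else M 1)"
  have prob: "prob_space (M' i)" for i
    using assms(1,3) by (auto simp: M'_def borel_prob_on_def)
  have \<mu>: "\<mu> = PiM {1..n} M'"
    unfolding assms(4) by (rule PiM_cong) (auto simp: M'_def)
  have herm_g: "hermitian_mat (g z)" if "z \<in> space \<mu>" for z
    using assms(5) that unfolding assms(7) suitable_def
    by (intro hermitian_mat_diff hermitian_mat_expectation) auto
  have max: "is_eigenvalue (f z - mat_expectation \<mu> f) (complex_of_real (lambda_max (g z)))"
    if "z \<in> space \<mu>" for z
    using Max_in[OF finite_nonempty_eigenvalues[OF herm_g[OF that]]]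
    by (simp add: lambda_max_def assms(7))
  have min: "is_eigenvalue (- f z - mat_expectation \<mu> (\<lambda>z. - f z)) (complex_of_real (- lambda_min (g z)))"
    if "z \<in> space \<mu>" for z
  proof -
    have "is_eigenvalue (g z) (complex_of_real (lambda_min (g z)))"
      using Min_in[OF finite_nonempty_eigenvalues[OF herm_g[OF that]]] by (simp add: lambda_min_def)
    then have "is_eigenvalue (- g z) (complex_of_real (- lambda_min (g z)))"
      unfolding is_eigenvalue_uminus .
    moreover have "- g z = - f z - mat_expectation \<mu> (\<lambda>z. - f z)"
      by (simp add: assms(7) mat_expectation_uminus)
    ultimately show ?thesis by simp
  qed
  have upper_tail: "ereal (measure \<mu> {z \<in> space \<mu>. lambda_max (g z) \<ge> t})
      \<le> ereal (real CARD('d)) * exp_ereal (- (ereal (t\<^sup>2) / (4 * v)))" if "0 \<le> t" for t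
    by (rule eigenvalue_concentration(1)[OF prob \<mu> assms(5,6) max that])
  have upper_mean: "ereal (integral\<^sup>L \<mu> (\<lambda>z. lambda_max (g z)))
      \<le> 2 * sqrt_ereal (v * ereal (ln (real CARD('d))))"
    by (rule eigenvalue_concentration(2)[OF prob \<mu> assms(5,6) max])
  have v': "v = variance_proxy n \<mu> (\<lambda>z. - f z)"
    unfolding variance_proxy_uminus by (rule assms(6))
  have "ereal (measure \<mu> {z \<in> space \<mu>. t \<le> - lambda_min (g z)})
      \<le> ereal (real CARD('d)) * exp_ereal (- (ereal (t\<^sup>2) / (4 * v)))" if "0 \<le> t" for t
    by (rule eigenvalue_concentration(1)[OF prob \<mu> suitable_uminus[OF assms(5)] v' min that])
  moreover have "{z \<in> space \<mu>. lambda_min (g z) \<le> - t} = {z \<in> space \<mu>. t \<le> - lambda_min (g z)}" for t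
    by auto
  ultimately have lower_tail: "ereal (measure \<mu> {z \<in> space \<mu>. lambda_min (g z) \<le> - t})
      \<le> ereal (real CARD('d)) * exp_ereal (- (ereal (t\<^sup>2) / (4 * v)))" if "0 \<le> t" for t
    using that by simp
  have "ereal (integral\<^sup>L \<mu> (\<lambda>z. - lambda_min (g z)))
      \<le> 2 * sqrt_ereal (v * ereal (ln (real CARD('d))))"
    by (rule eigenvalue_concentration(2)[OF prob \<mu> suitable_uminus[OF assms(5)] v' min])
  then have lower_mean: "ereal (integral\<^sup>L \<mu> (\<lambda>z. lambda_min (g z)))
      \<ge> - (2 * sqrt_ereal (v * ereal (ln (real CARD('d)))))"
    by (simp add: ereal_uminus_le_reorder)
  from upper_tail upper_mean lower_tail lower_mean show ?thesis by blast
qed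

end
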